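(* Let $M$ be a smooth surface with Riemannian metric $a$, and let $(x^1,x^2)$ be isothermal coordinates on $M$, in which $a_{ij}=e^{2\nu(x^1,x^2)}\delta_{ij}$. Let $F=\alpha\,\phi(\beta/\alpha)$ be an $(\alpha,\beta)$-metric, with $\alpha=\sqrt{a_{ij}y^iy^j}$ and $\beta=b_1(x^1,x^2)y^1+b_2(x^1,x^2)y^2$, and let $\overline F(x,y)=F(x,-y)$. Assume that neither $F$ nor $\overline F$ is projectively equivalent to $(M,\alpha)$. For $t\in[0,2\pi)$ put $$s=\beta=e^{-\nu}(b_1\cos t+b_2\sin t),\qquad \beta'_t=\frac{\partial\beta}{\partial t}=e^{-\nu}(-b_1\sin t+b_2\cos t),\qquad b^2=e^{-2\nu}(b_1^2+b_2^2).$$ Then the necessary and sufficient condition for $F$ and $\overline F$ to be projectively equivalent is $$\sqrt{b^2-s^2}\cdot\mathcal E(s)\cdot\mathcal M+\mathcal F(s)\cdot e^{-\nu(x^1,x^2)}\,\mathrm{curl}_{21}=0,$$ where $$\mathcal E(s)=s\big(\phi'(s)\phi''(-s)+\phi'(-s)\phi''(s)\big)+\big(\phi(-s)\phi''(s)-\phi(s)\phi''(-s)\big),$$ $$\mathcal F(s)=(b^2-s^2)\big(\phi'(s)\phi''(-s)+\phi'(-s)\phi''(s)\big)+\big(\phi(-s)\phi'(s)+\phi(s)\phi'(-s)\big),$$ $$\mathcal M=e^{-\nu}\Big(\frac{\partial b_1}{\partial x^1}\cos^2t+\sin t\cos t\Big(\frac{\partial b_1}{\partial x^2}+\frac{\partial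 b_2}{\partial x^1}\Big)+\frac{\partial b_2}{\partial x^2}\sin^2t\Big)+\beta'_t\Big(\frac{\partial\nu}{\partial x^2}\cos t-\frac{\partial\nu}{\partial x^1}\sin t\Big)-\beta\Big(\frac{\partial\nu}{\partial x^1}\cos t+\frac{\partial\nu}{\partial x^2}\sin t\Big),$$ $$\mathrm{curl}_{21}=\frac{\partial b_2}{\partial x^1}-\frac{\partial b_1}{\partial x^2}.$$
   Context: A Finsler norm on $M$ is a function $F:TM\to[0,\infty)$ that is positive and smooth on $TM\setminus\{0\}$, satisfies $F(x,\lambda y)=\lambda F(x,y)$ for all $\lambda>0$, and has positive definite Hessian $g_{ij}=\frac12\frac{\partial^2F^2}{\partial y^i\partial y^j}$ on $TM\setminus\{0\}$. An $(\alpha,\beta)$-metric is a Finsler norm $F=\alpha\,\phi(\beta/\alpha)$, where $\alpha(x,y)=\sqrt{a_{ij}(x)y^iy^j}$ for a Riemannian metric $a$, $\beta(x,y)=b_i(x)y^i$ is a smooth $1$-form, $\|\beta_x\|_a<b_0$ and $\|\beta_x\|_a<1$ for all $x$, and $\phi:(-b_0,b_0)\to(0,\infty)$ is $C^\infty$ with $\phi(s)-s\phi'(s)+(b^2-s^2)\phi''(s)>0$ for all $|s|\le b<b_0$. Here $\phi'(-s)$ and $\phi''(-s)$ denote the derivatives $\phi'$ and $\phi''$ evaluated at the point $-s$. The $a$-unit circle in $T_xM$ is parametrized by $y^1=e^{-\nu}\cos t$, $y^2=e^{-\nu}\sin t$, $t\in[0,2\pi)$; there $\alpha=1$ and $\beta/\alpha=\beta=s$,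 and $(\beta'_t)^2=b^2-s^2$. The condition is an identity in $(x^1,x^2,t)$. Two Finsler structures are projectively equivalent if their geodesics coincide as oriented unparametrized curves. *)

theory Defs
  imports "HOL-Analysis.Analysis"
begin

text \<open>
  The surface is identified with the open set \<open>U\<close> of the plane over which the coordinates
  \<open>(x\<^sup>1, x\<^sup>2)\<close> range, its tangent bundle with \<open>U \<times> \<real>\<^sup>2\<close>, and a tensor field with its
  components in these coordinates.
\<close>

subsection \<open>Smooth functions and partial derivatives\<close>

text \<open>
  On an open subset of a finite-dimensional space, a function is \<open>C\<^sup>k\<^sup>+\<^sup>1\<close> iff it is differentiable
  and all its directional derivatives are \<open>C\<^sup>k\<close>.
\<close>

primrec Ck_on ::
  "nat \<Rightarrow> 'a::euclidean_space set \<Rightarrow> ('a \<Rightarrow> 'b::real_normed_vector) \<Rightarrow> bool" where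
  "Ck_on 0 S f \<longleftrightarrow> continuous_on S f"
| "Ck_on (Suc k) S f \<longleftrightarrow>
     (\<forall>x\<in>S. f differentiable (at x)) \<and> (\<forall>v. Ck_on k S (\<lambda>x. frechet_derivative f (at x) v))"

definition smooth_on :: "'a::euclidean_space set \<Rightarrow> ('a \<Rightarrow> 'b::real_normed_vector) \<Rightarrow> bool" where
  "smooth_on S f \<longleftrightarrow> (\<forall>k. Ck_on k S f)"

definition partial_deriv :: "2 \<Rightarrow> (real^2 \<Rightarrow> real) \<Rightarrow> real^2 \<Rightarrow> real" where
  "partial_deriv i f x = frechet_derivative f (at x) (axis i 1)"

subsection \<open>Finsler norms\<close>

text \<open>\<open>F x y\<close> is the value of the norm at the tangent vector \<open>y\<close> with base point \<open>x\<close>.\<close>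

definition fundamental_tensor ::
  "(real^2 \<Rightarrow> real^2 \<Rightarrow> real) \<Rightarrow> real^2 \<Rightarrow> real^2 \<Rightarrow> real^2^2" where
  "fundamental_tensor F x y =
     (\<chi> i j. 1/2 * partial_deriv i (partial_deriv j (\<lambda>z. (F x z)\<^sup>2)) y)"

definition finsler_norm :: "(real^2) set \<Rightarrow> (real^2 \<Rightarrow> real^2 \<Rightarrow> real) \<Rightarrow> bool" where
  "finsler_norm U F \<longleftrightarrow>
     (\<forall>x\<in>U. \<forall>y. F x y \<ge> 0) \<and>
     (\<forall>x\<in>U. \<forall>y. y \<noteq> 0 \<longrightarrow> F x y > 0) \<and>
     smooth_on (U \<times> (- {0})) (\<lambda>(x, y). F x y) \<and>
     (\<forall>x\<in>U. \<forall>y. \<forall>c>0. F x (c *\<^sub>R y) = c * F x y) \<and>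
     (\<forall>x\<in>U. \<forall>y. y \<noteq> 0 \<longrightarrow>
        (\<forall>v. v \<noteq> 0 \<longrightarrow> v \<bullet> (fundamental_tensor F x y *v v) > 0))"

definition reverse_norm :: "(real^2 \<Rightarrow> real^2 \<Rightarrow> real) \<Rightarrow> real^2 \<Rightarrow> real^2 \<Rightarrow> real" where
  "reverse_norm F x y = F x (- y)"

subsection \<open>Geodesics and projective equivalence\<close>

text \<open>
  Geodesics, on an open interval \<open>I\<close>, are the nonconstant solutions of the Euler-Lagrange equations
  \<open>d/dr (\<partial>E/\<partial>y\<^sup>i) = \<partial>E/\<partial>x\<^sup>i\<close> of the energy \<open>E = F\<^sup>2/2\<close>.  They have constant nonzero \<open>F\<close>-speed,
  so requiring a nonvanishing velocity excludes exactly the constant curves.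
\<close>

definition energy :: "(real^2 \<Rightarrow> real^2 \<Rightarrow> real) \<Rightarrow> real^2 \<Rightarrow> real^2 \<Rightarrow> real" where
  "energy F x y = (F x y)\<^sup>2 / 2"

definition geodesic ::
  "(real^2) set \<Rightarrow> (real^2 \<Rightarrow> real^2 \<Rightarrow> real) \<Rightarrow> real set \<Rightarrow> (real \<Rightarrow> real^2) \<Rightarrow> bool" where
  "geodesic U F I c \<longleftrightarrow>
     open I \<and> is_interval I \<and> I \<noteq> {} \<and> c ` I \<subseteq> U \<and> Ck_on 2 I c \<and>
     (\<forall>r\<in>I. vector_derivative c (at r) \<noteq> 0) \<and>
     (\<forall>r\<in>I. \<forall>i.
        ((\<lambda>r. partial_deriv i (\<lambda>y. energy F (c r) y) (vector_derivative c (at r)))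
           has_real_derivative
         partial_deriv i (\<lambda>x. energy F x (vector_derivative c (at r))) (c r)) (at r))"

text \<open>\<open>d\<close> on \<open>J\<close> is an orientation preserving reparametrization of \<open>c\<close> on \<open>I\<close>.\<close>

definition same_oriented_curve ::
  "real set \<Rightarrow> (real \<Rightarrow> real^2) \<Rightarrow> real set \<Rightarrow> (real \<Rightarrow> real^2) \<Rightarrow> bool" where
  "same_oriented_curve I c J d \<longleftrightarrow>
     (\<exists>h. Ck_on 2 J h \<and> (\<forall>r\<in>J. deriv h r > 0) \<and> h ` J = I \<and> (\<forall>r\<in>J. d r = c (h r)))"

definition projectively_equivalent ::
  "(real^2) set \<Rightarrow> (real^2 \<Rightarrow> real^2 \<Rightarrow> real) \<Rightarrow> (real^2 \<Rightarrow> real^2 \<Rightarrow> real) \<Rightarrow> bool" where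
  "projectively_equivalent U F G \<longleftrightarrow>
     (\<forall>I c. geodesic U F I c \<longrightarrow> (\<exists>J d. geodesic U G J d \<and> same_oriented_curve I c J d)) \<and>
     (\<forall>I c. geodesic U G I c \<longrightarrow> (\<exists>J d. geodesic U F J d \<and> same_oriented_curve I c J d))"

subsection \<open>Riemannian metrics and \<open>(\<alpha>,\<beta>)\<close>-metrics\<close>

definition riemannian_metric :: "(real^2) set \<Rightarrow> (real^2 \<Rightarrow> real^2^2) \<Rightarrow> bool" where
  "riemannian_metric U a \<longleftrightarrow>
     smooth_on U a \<and>
     (\<forall>x\<in>U. transpose (a x) = a x \<and> (\<forall>v. v \<noteq> 0 \<longrightarrow> v \<bullet> (a x *v v) > 0))"

definition isothermal ::
  "(real^2) set \<Rightarrow> (real^2 \<Rightarrow> real^2^2) \<Rightarrow> (real^2 \<Rightarrow> real) \<Rightarrow> bool" where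
  "isothermal U a \<nu> \<longleftrightarrow>
     smooth_on U \<nu> \<and> (\<forall>x\<in>U. \<forall>i j. a x $ i $ j = exp (2 * \<nu> x) * (if i = j then 1 else 0))"

definition alpha :: "(real^2 \<Rightarrow> real^2^2) \<Rightarrow> real^2 \<Rightarrow> real^2 \<Rightarrow> real" where
  "alpha a x y = sqrt (\<Sum>i\<in>UNIV. \<Sum>j\<in>UNIV. a x $ i $ j * y $ i * y $ j)"

definition beta :: "(real^2 \<Rightarrow> real^2) \<Rightarrow> real^2 \<Rightarrow> real^2 \<Rightarrow> real" where
  "beta b x y = (\<Sum>i\<in>UNIV. b x $ i * y $ i)"

definition form_norm :: "(real^2 \<Rightarrow> real^2^2) \<Rightarrow> (real^2 \<Rightarrow> real^2) \<Rightarrow> real^2 \<Rightarrow> real" where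
  "form_norm a b x = sqrt (\<Sum>i\<in>UNIV. \<Sum>j\<in>UNIV. matrix_inv (a x) $ i $ j * b x $ i * b x $ j)"

text \<open>
  Allowing \<open>b\<^sub>0 = \<infinity>\<close> would give nothing new: since \<open>\<parallel>\<beta>\<^sub>x\<parallel> < 1\<close>, one may then restrict \<open>\<phi>\<close> to
  \<open>(-1, 1)\<close>.
\<close>

definition alpha_beta_metric ::
  "(real^2) set \<Rightarrow> (real^2 \<Rightarrow> real^2^2) \<Rightarrow> (real^2 \<Rightarrow> real^2) \<Rightarrow> real \<Rightarrow> (real \<Rightarrow> real) \<Rightarrow>
     (real^2 \<Rightarrow> real^2 \<Rightarrow> real) \<Rightarrow> bool" where
  "alpha_beta_metric U a b b0 \<phi> F \<longleftrightarrow>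
     riemannian_metric U a \<and> smooth_on U b \<and>
     b0 > 0 \<and> (\<forall>x\<in>U. form_norm a b x < b0 \<and> form_norm a b x < 1) \<and>
     (\<forall>s\<in>{-b0<..<b0}. \<phi> s > 0) \<and> smooth_on {-b0<..<b0} \<phi> \<and>
     (\<forall>s r. \<bar>s\<bar> \<le> r \<and> r < b0 \<longrightarrow>
        \<phi> s - s * deriv \<phi> s + (r\<^sup>2 - s\<^sup>2) * deriv (deriv \<phi>) s > 0) \<and>
     (\<forall>x\<in>U. \<forall>y. F x y = alpha a x y * \<phi> (beta b x y / alpha a x y)) \<and>
     finsler_norm U F"

subsection \<open>The coefficients of the condition\<close>

definition calE :: "(real \<Rightarrow> real) \<Rightarrow> real \<Rightarrow> real" where
  "calE \<phi> s =
     s * (deriv \<phi> s * deriv (deriv \<phi>) (- s) + deriv \<phi> (- s) * deriv (deriv \<phi>) s)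
     + (\<phi> (- s) * deriv (deriv \<phi>) s - \<phi> s * deriv (deriv \<phi>) (- s))"

text \<open>The argument \<open>bsq\<close> stands for \<open>b\<^sup>2\<close>.\<close>

definition calF :: "(real \<Rightarrow> real) \<Rightarrow> real \<Rightarrow> real \<Rightarrow> real" where
  "calF \<phi> bsq s =
     (bsq - s\<^sup>2) * (deriv \<phi> s * deriv (deriv \<phi>) (- s) + deriv \<phi> (- s) * deriv (deriv \<phi>) s)
     + (\<phi> (- s) * deriv \<phi> s + \<phi> s * deriv \<phi> (- s))"

definition calM :: "(real^2 \<Rightarrow> real) \<Rightarrow> (real^2 \<Rightarrow> real^2) \<Rightarrow> real^2 \<Rightarrow> real \<Rightarrow> real" where
  "calM \<nu> b x t =
     (let \<beta> = exp (- \<nu> x) * (b x $ 1 * cos t + b x $ 2 * sin t);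
          \<beta>t = exp (- \<nu> x) * (- (b x $ 1) * sin t + b x $ 2 * cos t)
      in exp (- \<nu> x) *
           (partial_deriv 1 (\<lambda>x. b x $ 1) x * (cos t)\<^sup>2
            + sin t * cos t * (partial_deriv 2 (\<lambda>x. b x $ 1) x + partial_deriv 1 (\<lambda>x. b x $ 2) x)
            + partial_deriv 2 (\<lambda>x. b x $ 2) x * (sin t)\<^sup>2)
         + \<beta>t * (partial_deriv 2 \<nu> x * cos t - partial_deriv 1 \<nu> x * sin t)
         - \<beta> * (partial_deriv 1 \<nu> x * cos t + partial_deriv 2 \<nu> x * sin t))"

definition curl21 :: "(real^2 \<Rightarrow> real^2) \<Rightarrow> real^2 \<Rightarrow> real" where
  "curl21 b x = partial_deriv 1 (\<lambda>x. b x $ 2) x - partial_deriv 2 (\<lambda>x. b x $ 1) x"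

end

theory Submission
  imports Defs
begin

text \<open>
  Parametrized by the angle \<open>t\<close> of the velocity, the unparametrized geodesics of \<open>F\<close> are the curves of
  Euclidean coordinate curvature \<open>\<kappa>(x, t) = D - (\<phi>''(s) \<beta>'\<^sub>t M + \<phi>'(s) c) / P(s)\<close>, where
  \<open>P(s) = \<phi>(s) - s \<phi>'(s) + (b\<^sup>2 - s\<^sup>2) \<phi>''(s) > 0\<close>, \<open>c = e\<^sup>-\<^sup>\<nu> curl\<^sub>2\<^sub>1\<close> and \<open>D\<close> depends on \<open>\<alpha>\<close> only.
  Passing to the reverse norm amounts to replacing \<open>\<beta>\<close> by \<open>-\<beta>\<close>, and equality of the two curvatures is
  \<open>\<beta>'\<^sub>t calE(s) M + calF(s) c = 0\<close>, with the signed factor \<open>\<beta>'\<^sub>t\<close> instead of \<open>\<surd>(b\<^sup>2 - s\<^sup>2) = \<bar>\<beta>'\<^sub>t\<bar>\<close>.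

  Each of the two conditions forces both summands to vanish.  With the absolute value this follows by
  comparing \<open>t\<close> and \<open>t + \<pi>\<close>.  With the sign, reflecting \<open>t\<close> in the direction of \<open>\<beta>\<close> turns the condition into
  \<open>calF(s) = k s (b\<^sup>2 - s\<^sup>2) calE(s)\<close> on \<open>[0, b]\<close> if \<open>c \<noteq> 0\<close>; this is a first-order linear equation for
  \<open>\<phi>(-s) \<phi>'(s) + \<phi>(s) \<phi>'(-s)\<close>, singular at \<open>0\<close> and \<open>b\<close>, and ellipticity leaves only the zero solution.
\<close>

subsection \<open>Smoothness\<close>

text \<open>Of the two Euler-Lagrange equations, the one along the velocity says that the
  \<open>F\<close>-speed is constant and can always be arranged by a change of parameter; the
  transverse one is cubic in the velocity and survives every change of parameter. Equal curvatures
  therefore suffice for projective equivalence. Conversely, curvatures can only be compared where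
  geodesics are known to exist, so one is needed through every point in every direction; the Picard
  theorem supplies it.

  In the signed condition a half turn gives no information: \<open>\<beta>'\<^sub>t\<close> and
  \<open>calE(s)\<close> both change sign, so the equation at \<open>t + \<pi>\<close> repeats the
  one at \<open>t\<close>. This forces the detour through a differential equation
  \<open>W' A = W R\<close>. A zero of \<open>A\<close> with \<open>R > 0\<close> acts on one side
  only: where \<open>A > 0\<close>, a nonzero solution can leave such a zero to the right
  (\<open>W = s\<close> for \<open>A = s\<close>, \<open>R = 1\<close>) but cannot run into one from
  the left. Hence the zeros of \<open>A\<close> at both ends of \<open>[0, b]\<close> matter: the
  one at \<open>b\<close> for points with \<open>A > 0\<close>, the one at \<open>0\<close> for
  points with \<open>A < 0\<close>.\<close>

lemma Ck_on_cong:
  assumes "open S" "\<And>x. x \<in> S \<Longrightarrow> f x = g x"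
  shows "Ck_on k S f \<longleftrightarrow> Ck_on k S g"
  using assms(2)
proof (induction k arbitrary: f g)
  case 0
  then show ?case by (simp cong: continuous_on_cong)
next
  case (Suc k)
  have diff: "f differentiable (at x) \<longleftrightarrow> g differentiable (at x)" if "x \<in> S" for x
    unfolding differentiable_def
    by (intro ex_cong1 iffI; erule has_derivative_transform_within_open[OF _ assms(1) that])
      (simp_all add: Suc.prems)
  have "Ck_on k S (\<lambda>x. frechet_derivative f (at x) v) \<longleftrightarrow> Ck_on k S (\<lambda>x. frechet_derivative g (at x) v)"
    if "\<forall>x\<in>S. f differentiable (at x)" for v
    by (intro Suc.IH fun_cong[OF frechet_derivative_transform_within_open[OF _ assms(1)]])
      (use that Suc.prems in auto)
  with diff show ?case by auto
qed

lemma Ck_on_bounded_linear: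
  assumes "open S" "bounded_linear L" "Ck_on k S f"
  shows "Ck_on k S (\<lambda>x. L (f x))"
  using assms(3)
proof (induction k arbitrary: f)
  case 0
  then show ?case using assms(2) by (auto intro: bounded_linear.continuous_on)
next
  case (Suc k)
  have D: "((\<lambda>x. L (f x)) has_derivative (\<lambda>v. L (frechet_derivative f (at x) v))) (at x)"
    if "x \<in> S" for x
    using Suc.prems that bounded_linear.has_derivative[OF assms(2)]
    by (auto simp: frechet_derivative_works)
  have "Ck_on k S (\<lambda>x. frechet_derivative (\<lambda>x. L (f x)) (at x) v)" for v
  proof -
    have "Ck_on k S (\<lambda>x. L (frechet_derivative f (at x) v))"
      using Suc by auto
    then show ?thesis
      by (rule iffD2[OF Ck_on_cong[OF assms(1)], rotated])
        (simp add: frechet_derivative_at[OF D, symmetric])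
  qed
  with D show ?case by (auto simp: differentiable_def)
qed

lemma smooth_on_bounded_linear:
  "open S \<Longrightarrow> bounded_linear L \<Longrightarrow> smooth_on S f \<Longrightarrow> smooth_on S (\<lambda>x. L (f x))"
  by (auto simp: smooth_on_def intro: Ck_on_bounded_linear)

lemma smooth_on_imp_continuous_on: "smooth_on S f \<Longrightarrow> continuous_on S f"
  unfolding smooth_on_def by (metis Ck_on.simps(1))

lemma smooth_on_frechet_derivative:
  "smooth_on S f \<Longrightarrow> smooth_on S (\<lambda>x. frechet_derivative f (at x) v)"
  unfolding smooth_on_def by (metis Ck_on.simps(2))

lemma smooth_on_has_derivative:
  "smooth_on S f \<Longrightarrow> x \<in> S \<Longrightarrow> (f has_derivative frechet_derivative f (at x)) (at x)"
  unfolding smooth_on_def by (metis Ck_on.simps(2) frechet_derivative_works)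

lemma frechet_derivative_real:
  fixes f :: "real \<Rightarrow> 'b::real_normed_vector"
  assumes "(f has_vector_derivative f') (at x)"
  shows "frechet_derivative f (at x) = (\<lambda>v. v *\<^sub>R f')"
  using assms frechet_derivative_at by (metis has_vector_derivative_def)

lemma smooth_on_DERIV:
  fixes f :: "real \<Rightarrow> real"
  assumes "smooth_on S f" "x \<in> S"
  shows "(f has_real_derivative deriv f x) (at x)"
  using smooth_on_has_derivative[OF assms]
  by (metis DERIV_deriv_iff_real_differentiable differentiable_def)

lemma smooth_on_deriv:
  fixes f :: "real \<Rightarrow> real"
  assumes "open S" "smooth_on S f"
  shows "smooth_on S (deriv f)"
proof -
  have "frechet_derivative f (at x) 1 = deriv f x" if "x \<in> S" for x
    by (simp add: frechet_derivative_real[OF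
          smooth_on_DERIV[OF assms(2) that, unfolded has_real_derivative_iff_has_vector_derivative]])
  then have "Ck_on k S (\<lambda>x. frechet_derivative f (at x) 1) \<longleftrightarrow> Ck_on k S (deriv f)" for k
    by (rule Ck_on_cong[OF assms(1)])
  then show ?thesis
    using smooth_on_frechet_derivative[OF assms(2), of 1] unfolding smooth_on_def by simp
qed

lemma Ck_on_2_realI:
  fixes c :: "real \<Rightarrow> 'b::real_normed_vector"
  assumes "open I" "\<And>r. r \<in> I \<Longrightarrow> (c has_vector_derivative y r) (at r)"
    "\<And>r. r \<in> I \<Longrightarrow> (y has_vector_derivative z r) (at r)" "continuous_on I z"
  shows "Ck_on 2 I c"
proof -
  \<comment> \<open>\<open>Ck_on\<close> ranges over all directions \<open>v\<close>, which on the
    real line merely scale the derivative; so all multiples of \<open>y\<close> are treated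
    together.\<close>
  have y: "Ck_on 1 I (\<lambda>r. v *\<^sub>R y r)" for v
  proof -
    have D: "((\<lambda>r. v *\<^sub>R y r) has_vector_derivative v *\<^sub>R z r) (at r)" if "r \<in> I" for r
      using assms(3)[OF that] by (auto intro: derivative_eq_intros)
    have "continuous_on I (\<lambda>r. frechet_derivative (\<lambda>r. v *\<^sub>R y r) (at r) w)" for w
    proof -
      have "continuous_on I (\<lambda>r. w *\<^sub>R v *\<^sub>R z r)"
        using assms(4) by (intro continuous_intros)
      then show ?thesis
        by (rule continuous_on_eq) (simp add: frechet_derivative_real[OF D])
    qed
    moreover have "(\<lambda>r. v *\<^sub>R y r) differentiable (at r)" if "r \<in> I" for r
      using D[OF that] differentiableI_vector by blast
    ultimately show ?thesis by simp
  qed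
  have "Ck_on 1 I (\<lambda>r. frechet_derivative c (at r) v)" for v
    using y[of v] by (rule iffD2[OF Ck_on_cong[OF assms(1)], rotated])
      (simp add: frechet_derivative_real[OF assms(2)])
  moreover have "c differentiable (at r)" if "r \<in> I" for r
    using assms(2)[OF that] differentiableI_vector by blast
  ultimately show ?thesis by (simp add: numeral_2_eq_2)
qed

lemma Ck_on_2_realD:
  fixes c :: "real \<Rightarrow> 'b::real_normed_vector"
  assumes "open I" "Ck_on 2 I c"
  defines "y \<equiv> \<lambda>r. vector_derivative c (at r)"
  defines "z \<equiv> \<lambda>r. vector_derivative y (at r)"
  shows "\<And>r. r \<in> I \<Longrightarrow> (c has_vector_derivative y r) (at r)"
    "\<And>r. r \<in> I \<Longrightarrow> (y has_vector_derivative z r) (at r)" "continuous_on I z"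
proof -
  have c: "c differentiable (at r)" "Ck_on (Suc 0) I (\<lambda>r. frechet_derivative c (at r) 1)" if "r \<in> I" for r
    using assms(2) that by (auto simp: numeral_2_eq_2)
  show cy: "(c has_vector_derivative y r) (at r)" if "r \<in> I" for r
    using c(1)[OF that] y_def vector_derivative_works by blast
  have "Ck_on (Suc 0) I (\<lambda>r. frechet_derivative c (at r) 1)"
    using assms(2) by (auto simp: numeral_2_eq_2)
  then have y: "Ck_on (Suc 0) I y"
    by (rule iffD1[OF Ck_on_cong[OF assms(1)], rotated]) (simp add: frechet_derivative_real[OF cy])
  show yz: "(y has_vector_derivative z r) (at r)" if "r \<in> I" for r
    using y that z_def vector_derivative_works by auto
  have "continuous_on I (\<lambda>r. frechet_derivative y (at r) 1)"
    using y by auto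
  then show "continuous_on I z"
    by (rule continuous_on_eq) (simp add: frechet_derivative_real[OF yz])
qed

subsection \<open>Locally Lipschitz functions and the Picard theorem\<close>

text \<open>Attached to a point, the notion passes through algebraic operations without tracking
  domains. The ball is closed because \<open>picard_local\<close> projects onto it and bounds
  \<open>G\<close> on it by compactness.\<close>

definition lipschitz_near :: "('a::metric_space \<Rightarrow> 'b::metric_space) \<Rightarrow> 'a \<Rightarrow> bool" where
  "lipschitz_near f p \<longleftrightarrow> (\<exists>e>0. \<exists>L. L-lipschitz_on (cball p e) f)"

lemma lipschitz_nearE2:
  assumes "lipschitz_near f p" "lipschitz_near g p"
  obtains e L M where "e > 0" "L-lipschitz_on (cball p e) f" "M-lipschitz_on (cball p e) g"
proof -
  obtain e L d M where "e > 0" "L-lipschitz_on (cball p e) f" "d > 0" "M-lipschitz_on (cball p d) g"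
    using assms unfolding lipschitz_near_def by blast
  then have "min e d > 0" "L-lipschitz_on (cball p (min e d)) f" "M-lipschitz_on (cball p (min e d)) g"
    by (auto elim: lipschitz_on_subset)
  then show ?thesis using that by blast
qed

lemma lipschitz_near_imp_isCont:
  fixes f :: "'a::metric_space \<Rightarrow> 'b::metric_space"
  assumes "lipschitz_near f p" shows "isCont f p"
proof -
  obtain e L where "e > 0" "L-lipschitz_on (cball p e) f"
    using assms unfolding lipschitz_near_def by blast
  then have "continuous_on (ball p e) f"
    by (meson ball_subset_cball lipschitz_on_continuous_on lipschitz_on_subset)
  then show ?thesis
    using \<open>e > 0\<close> by (simp add: continuous_on_eq_continuous_at)
qed

lemma lipschitz_near_const: "lipschitz_near (\<lambda>x. c) p"
  unfolding lipschitz_near_def by (intro exI[of _ 1] conjI exI[of _ 0] lipschitz_on_constant) simp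

lemma lipschitz_near_bounded_linear: "bounded_linear f \<Longrightarrow> lipschitz_near f p"
  by (erule bounded_linear.lipschitz_boundE[of f "cball p 1"])
    (auto simp: lipschitz_near_def intro: exI[of _ "1::real"])

lemma lipschitz_near_Pair:
  assumes "lipschitz_near f p" "lipschitz_near g p"
  shows "lipschitz_near (\<lambda>x. (f x, g x)) p"
  by (rule lipschitz_nearE2[OF assms])
    (unfold lipschitz_near_def, intro exI conjI, assumption, erule lipschitz_on_Pair, assumption)

lemma lipschitz_near_add:
  fixes f g :: "'a::metric_space \<Rightarrow> 'b::real_normed_vector"
  assumes "lipschitz_near f p" "lipschitz_near g p"
  shows "lipschitz_near (\<lambda>x. f x + g x) p"
  by (rule lipschitz_nearE2[OF assms])
    (unfold lipschitz_near_def, intro exI conjI, assumption, erule lipschitz_on_add, assumption)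

lemma lipschitz_near_compose:
  assumes "lipschitz_near f p" "lipschitz_near g (f p)"
  shows "lipschitz_near (\<lambda>x. g (f x)) p"
proof -
  obtain e L d M where *: "e > 0" "L-lipschitz_on (cball p e) f" "d > 0" "M-lipschitz_on (cball (f p) d) g"
    using assms unfolding lipschitz_near_def by blast
  obtain e' where e': "e' > 0" "\<And>x. dist x p < e' \<Longrightarrow> dist (f x) (f p) < d"
    using lipschitz_near_imp_isCont[OF assms(1)] \<open>d > 0\<close> unfolding continuous_at_eps_delta by blast
  \<comment> \<open>Halving \<open>e'\<close> turns the strict inequality of continuity into one
    valid on a closed ball.\<close>
  define r where "r = min e (e' / 2)"
  have r: "r > 0" "cball p r \<subseteq> cball p e" using * e' by (auto simp: r_def)
  have "f ` cball p r \<subseteq> cball (f p) d"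
  proof
    fix w assume "w \<in> f ` cball p r"
    then obtain x where "w = f x" "dist p x \<le> r" by auto
    moreover have "r < e'" using e' by (simp add: r_def)
    ultimately show "w \<in> cball (f p) d" using e'(2)[of x] by (simp add: dist_commute less_imp_le)
  qed
  then have "(M * L)-lipschitz_on (cball p r) (g \<circ> f)"
    using * r by (intro lipschitz_on_compose) (auto elim: lipschitz_on_subset)
  then show ?thesis unfolding lipschitz_near_def using r by (auto simp: o_def)
qed

text \<open>\<open>Ck_on\<close> gives continuity of the derivative only one direction at a time.
  Compactness bounds each direction, summing over a basis bounds the operator norm, and the mean
  value inequality applies on the convex ball.\<close>

lemma lipschitz_near_C1:
  fixes f :: "'a::euclidean_space \<Rightarrow> 'b::real_normed_vector"
  assumes "open S" "p \<in> S" "Ck_on 1 S f"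
  shows "lipschitz_near f p"
proof -
  obtain e where e: "e > 0" "cball p e \<subseteq> S" using assms open_contains_cball by blast
  let ?D = "\<lambda>x. frechet_derivative f (at x)"
  have D: "(f has_derivative ?D x) (at x)" if "x \<in> S" for x
    using assms(3) that by (auto simp: frechet_derivative_works)
  have "\<exists>C. \<forall>x\<in>cball p e. norm (?D x v) \<le> C" for v
  proof -
    have "continuous_on S (\<lambda>x. ?D x v)" using assms(3) by auto
    then have "continuous_on (cball p e) (\<lambda>x. ?D x v)" using e continuous_on_subset by blast
    then have "bounded ((\<lambda>x. ?D x v) ` cball p e)"
      by (intro compact_imp_bounded compact_continuous_image) auto
    then show ?thesis by (auto simp: bounded_iff)
  qed
  then obtain C where C: "\<And>v x. x \<in> cball p e \<Longrightarrow> norm (?D x v) \<le> C v" by metis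
  define L where "L = (\<Sum>i\<in>Basis. C i)"
  have bnd: "onorm (?D x) \<le> L" if x: "x \<in> cball p e" for x
  proof (rule onorm_le)
    fix v
    interpret bounded_linear "?D x" using D x e has_derivative_bounded_linear by blast
    have "norm (?D x v) = norm (?D x (\<Sum>i\<in>Basis. (v \<bullet> i) *\<^sub>R i))"
      by (simp add: euclidean_representation)
    also have "\<dots> \<le> (\<Sum>i\<in>Basis. \<bar>v \<bullet> i\<bar> * norm (?D x i))"
      by (simp add: sum scale norm_sum[THEN order_trans])
    also have "\<dots> \<le> (\<Sum>i\<in>Basis. norm v * C i)"
      by (intro sum_mono mult_mono Basis_le_norm C x) auto
    finally show "norm (?D x v) \<le> L * norm v"
      by (simp add: L_def sum_distrib_left mult.commute)
  qed
  have "L-lipschitz_on (cball p e) f"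
  proof (rule lipschitz_onI)
    have "p \<in> cball p e" using e by auto
    then show "0 \<le> L" using bnd[of p] onorm_pos_le[of "?D p"] D assms(2)
        has_derivative_bounded_linear by (meson order_trans)
    show "dist (f x) (f y) \<le> L * dist x y" if "x \<in> cball p e" "y \<in> cball p e" for x y
      unfolding dist_norm
      using that e D by (intro differentiable_bound[of "cball p e" f ?D])
        (auto intro!: bnd[unfolded mem_cball] has_derivative_at_withinI D)
  qed
  then show ?thesis using e unfolding lipschitz_near_def by blast
qed

lemma lipschitz_near_smooth:
  "open S \<Longrightarrow> p \<in> S \<Longrightarrow> smooth_on S f \<Longrightarrow> lipschitz_near f p"
  by (rule lipschitz_near_C1) (auto simp only: smooth_on_def)

lemma lipschitz_near_DERIV:
  fixes f :: "real \<Rightarrow> real"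
  assumes "open S" "p \<in> S" "\<And>x. x \<in> S \<Longrightarrow> (f has_real_derivative f' x) (at x)" "continuous_on S f'"
  shows "lipschitz_near f p"
proof (rule lipschitz_near_C1[OF assms(1,2)])
  have f': "frechet_derivative f (at x) = (\<lambda>v. v *\<^sub>R f' x)" if "x \<in> S" for x
    by (rule frechet_derivative_real[OF
          assms(3)[OF that, unfolded has_real_derivative_iff_has_vector_derivative]])
  have "continuous_on S (\<lambda>x. frechet_derivative f (at x) v)" for v
  proof -
    have "continuous_on S (\<lambda>x. v *\<^sub>R f' x)"
      using assms(4) by (intro continuous_intros)
    then show ?thesis by (rule continuous_on_eq) (simp add: f')
  qed
  then show "Ck_on 1 S f"
    using assms(3) by (auto simp: real_differentiable_def)
qed

text \<open>Polarization writes a product as a combination of squares, and squaring is composition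
  with a continuously differentiable function.\<close>

lemma lipschitz_near_mult:
  fixes f g :: "'a::metric_space \<Rightarrow> real"
  assumes "lipschitz_near f p" "lipschitz_near g p"
  shows "lipschitz_near (\<lambda>x. f x * g x) p"
proof -
  have sq: "lipschitz_near (\<lambda>x. (h x)\<^sup>2) p" if "lipschitz_near h p" for h :: "'a \<Rightarrow> real"
    by (rule lipschitz_near_compose[OF that, of "\<lambda>x. x\<^sup>2"],
        rule lipschitz_near_DERIV[of UNIV _ _ "\<lambda>x. 2 * x"])
      (auto intro!: derivative_eq_intros continuous_intros)
  have cm: "lipschitz_near (\<lambda>x. c * h x) p" if "lipschitz_near h p" for h :: "'a \<Rightarrow> real" and c
    by (rule lipschitz_near_compose[OF that, of "\<lambda>x. c * x"])
      (intro lipschitz_near_bounded_linear bounded_linear_mult_right)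
  have "(\<lambda>x. f x * g x) = (\<lambda>x. (1/4) * ((f x + g x)\<^sup>2 + (- 1) * (f x + (- 1) * g x)\<^sup>2))"
    by (auto simp: fun_eq_iff power2_eq_square algebra_simps)
  then show ?thesis
    by (simp only:) (intro cm sq lipschitz_near_add assms)
qed

lemma lipschitz_near_diff:
  fixes f g :: "'a::metric_space \<Rightarrow> real"
  assumes "lipschitz_near f p" "lipschitz_near g p"
  shows "lipschitz_near (\<lambda>x. f x - g x) p"
  using lipschitz_near_add[OF assms(1) lipschitz_near_mult[OF lipschitz_near_const[of "-1"] assms(2)]]
  by simp

lemma lipschitz_near_divide:
  fixes f g :: "'a::metric_space \<Rightarrow> real"
  assumes "lipschitz_near f p" "lipschitz_near g p" "g p \<noteq> 0"
  shows "lipschitz_near (\<lambda>x. f x / g x) p"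
proof -
  have "lipschitz_near (inverse :: real \<Rightarrow> real) (g p)"
    by (rule lipschitz_near_DERIV[of "- {0}" _ _ "\<lambda>x. - (inverse x * inverse x)"])
      (use assms(3) in \<open>auto intro!: derivative_eq_intros continuous_intros\<close>)
  from lipschitz_near_mult[OF assms(1) lipschitz_near_compose[OF assms(2) this]]
  show ?thesis by (simp add: divide_inverse)
qed

lemmas lipschitz_near_intros = lipschitz_near_const lipschitz_near_add lipschitz_near_diff
  lipschitz_near_mult lipschitz_near_divide

text \<open>The integral operator contracts by the factor \<open>1 / 2\<close> on the complete space
  of bounded continuous functions on the whole line; the bound \<open>B\<close> keeps its values in
  that space.\<close>

lemma picard_global:
  fixes G :: "'a::euclidean_space \<Rightarrow> 'a"
  assumes L: "L-lipschitz_on UNIV G" and B: "\<And>x. norm (G x) \<le> B"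
    and d: "d > 0" "d * L \<le> 1 / 2"
  obtains z where "continuous_on UNIV z"
    "\<And>t. t \<in> {0..d} \<Longrightarrow> z t = z0 + integral {0..t} (\<lambda>s. G (z s))"
proof -
  have G: "continuous_on UNIV G" using L lipschitz_on_continuous_on by blast
  have L0: "L \<ge> 0" using L lipschitz_on_nonneg by blast
  have int: "(\<lambda>s. G (apply_bcontfun z s)) integrable_on {0..t}" for z :: "real \<Rightarrow>\<^sub>C 'a" and t
    by (intro integrable_continuous_interval continuous_on_compose2[OF G]) auto
  \<comment> \<open>Clamping \<open>t\<close> to \<open>{0..d}\<close> makes the integral bounded on
    the whole line and changes nothing for \<open>t\<close> in that interval.\<close>
  define T where "T z t = z0 + integral {0..max 0 (min d t)} (\<lambda>s. G (apply_bcontfun z s))"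
    for z :: "real \<Rightarrow>\<^sub>C 'a" and t
  have nb: "norm (integral {0..t} (\<lambda>s. G (apply_bcontfun z s))) \<le> B * t" if "t \<ge> 0" for z t
    using integral_bound[of 0 t "\<lambda>s. G (apply_bcontfun z s)" B] that B
    by (auto intro: continuous_on_compose2[OF G])
  have B0: "B \<ge> 0" using B norm_ge_zero order_trans by blast
  have Tc: "T z \<in> bcontfun" for z
  proof (rule bcontfun_normI)
    have "continuous_on {0..d} (\<lambda>t. integral {0..t} (\<lambda>s. G (apply_bcontfun z s)))"
      by (rule indefinite_integral_continuous_1[OF int])
    then have "continuous_on UNIV (\<lambda>t. integral {0..max 0 (min d t)} (\<lambda>s. G (apply_bcontfun z s)))"
      by (rule continuous_on_compose2) (use d in \<open>auto intro!: continuous_intros\<close>)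
    then show "continuous_on UNIV (T z)" unfolding T_def by (intro continuous_intros)
    show "norm (T z t) \<le> norm z0 + B * d" for t
    proof -
      have "norm (T z t) \<le> norm z0 + B * max 0 (min d t)"
        unfolding T_def 
        by (rule order_trans[OF norm_triangle_ineq add_left_mono[OF nb]]) simp
      also have "\<dots> \<le> norm z0 + B * d" using B0 d by (intro add_left_mono mult_left_mono) auto
      finally show ?thesis .
    qed
  qed
  have contr: "dist (Bcontfun (T z)) (Bcontfun (T w)) \<le> (1/2) * dist z w" for z w
  proof (rule dist_bound)
    fix t
    let ?t = "max 0 (min d t)"
    have "dist (apply_bcontfun (Bcontfun (T z)) t) (apply_bcontfun (Bcontfun (T w)) t)
        = norm (integral {0..?t} (\<lambda>s. G (apply_bcontfun z s) - G (apply_bcontfun w s)))"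
      by (simp add: Bcontfun_inverse[OF Tc] dist_norm T_def integral_diff int)
    also have "\<dots> \<le> (L * dist z w) * (?t - 0)"
    proof (rule integral_bound)
      show "continuous_on {0..?t} (\<lambda>s. G (apply_bcontfun z s) - G (apply_bcontfun w s))"
        by (intro continuous_intros continuous_on_compose2[OF G]) auto
      fix s
      have "norm (G (apply_bcontfun z s) - G (apply_bcontfun w s)) \<le> L * dist (apply_bcontfun z s) (apply_bcontfun w s)"
        using L unfolding lipschitz_on_def dist_norm by auto
      also have "\<dots> \<le> L * dist z w" using L0 dist_bounded by (intro mult_left_mono) auto
      finally show "norm (G (apply_bcontfun z s) - G (apply_bcontfun w s)) \<le> L * dist z w" .
    qed auto
    also have "\<dots> \<le> (L * dist z w) * d" using L0 d by (intro mult_left_mono) auto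
    also have "\<dots> = (d * L) * dist z w" by simp
    also have "\<dots> \<le> (1/2) * dist z w" using d by (intro mult_right_mono) auto
    finally show "dist (apply_bcontfun (Bcontfun (T z)) t) (apply_bcontfun (Bcontfun (T w)) t) \<le> (1/2) * dist z w" .
  qed
  have "\<exists>!z. Bcontfun (T z) = z"
    by (rule banach_fix_type[of "1/2"]) (simp_all only: contr, simp_all)
  then obtain z where z: "Bcontfun (T z) = z" by (elim ex1E)
  have "apply_bcontfun z = T z"
    using Bcontfun_inverse[OF Tc, of z] unfolding z .
  then have "apply_bcontfun z t = T z t" for t
    by (rule fun_cong)
  moreover have "max 0 (min d t) = t" if "t \<in> {0..d}" for t
    using that by auto
  ultimately have "apply_bcontfun z t = z0 + integral {0..t} (\<lambda>s. G (apply_bcontfun z s))"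
    if "t \<in> {0..d}" for t
    using that unfolding T_def by metis
  then show ?thesis
    using that continuous_on_apply_bcontfun by blast
qed

text \<open>Composing \<open>G\<close> with the nearest-point projection onto the ball, which does
  not increase distances, yields a bounded and globally Lipschitz field. It agrees with
  \<open>G\<close> as long as the solution stays in the ball.\<close>

lemma picard_local:
  fixes G :: "'a::euclidean_space \<Rightarrow> 'a"
  assumes "lipschitz_near G z0"
  obtains d z where "d > 0" "continuous_on {0..d} z" "z 0 = z0"
    "\<And>t. t \<in> {0<..<d} \<Longrightarrow> (z has_vector_derivative G (z t)) (at t)"
proof -
  obtain e L where e: "e > 0" "L-lipschitz_on (cball z0 e) G"
    using assms lipschitz_near_def by blast
  define H where "H x = G (closest_point (cball z0 e) x)" for x
  have ne: "cball z0 e \<noteq> {}" using e by auto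
  have cp: "closest_point (cball z0 e) x \<in> cball z0 e" for x
    using closest_point_in_set ne by blast
  have H: "L-lipschitz_on UNIV H"
  proof (rule lipschitz_onI)
    show "L \<ge> 0" using e lipschitz_on_nonneg by blast
    show "dist (H x) (H y) \<le> L * dist x y" for x y
    proof -
      have "dist (H x) (H y) \<le> L * dist (closest_point (cball z0 e) x) (closest_point (cball z0 e) y)"
        using e cp unfolding H_def by (meson lipschitz_onD)
      also have "\<dots> \<le> L * dist x y"
        by (rule mult_left_mono[OF closest_point_lipschitz[OF _ _ ne] \<open>L \<ge> 0\<close>]) auto
      finally show ?thesis .
    qed
  qed
  have "bounded (G ` cball z0 e)"
    using e by (intro compact_imp_bounded compact_continuous_image lipschitz_on_continuous_on) auto
  then obtain B where "\<And>x. x \<in> cball z0 e \<Longrightarrow> norm (G x) \<le> B"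
    unfolding bounded_iff by blast
  then have B: "norm (H x) \<le> B" for x using cp H_def by auto
  have B0: "B \<ge> 0" using B norm_ge_zero order_trans by blast
  have L0: "L \<ge> 0" using e lipschitz_on_nonneg by blast
  \<comment> \<open>The first bound yields the contraction, the second keeps the solution within
    \<open>B * d \<le> e\<close> of \<open>z0\<close>; the added ones guard against division by
    \<open>0\<close>.\<close>
  define d where "d = min (1 / (2 * (L + 1))) (e / (B + 1))"
  have d: "d > 0" using L0 B0 e by (auto simp: d_def)
  have "d * L \<le> 1 / (2 * (L + 1)) * L" using L0 by (intro mult_right_mono) (auto simp: d_def)
  also have "\<dots> \<le> 1 / 2" using L0 by (simp add: field_simps)
  finally have dL: "d * L \<le> 1 / 2" .
  have "B * d \<le> B * (e / (B + 1))" using B0 by (intro mult_left_mono) (auto simp: d_def)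
  also have "\<dots> \<le> e" using B0 e by (simp add: field_simps)
  finally have dB: "B * d \<le> e" .
  obtain z where z: "continuous_on UNIV z"
    "\<And>t. t \<in> {0..d} \<Longrightarrow> z t = z0 + integral {0..t} (\<lambda>s. H (z s))"
    using picard_global[OF H B d dL] by blast
  have Hz: "continuous_on S (\<lambda>s. H (z s))" for S
    using continuous_on_compose2[OF lipschitz_on_continuous_on[OF H] z(1)]
    by (meson continuous_on_subset top_greatest)
  have HG: "H (z t) = G (z t)" if t: "t \<in> {0..d}" for t
  proof -
    have "dist (z t) z0 = norm (integral {0..t} (\<lambda>s. H (z s)))"
      using z(2)[OF t] by (simp add: dist_norm)
    also have "\<dots> \<le> B * (t - 0)" using t by (intro integral_bound Hz B) auto
    also have "\<dots> \<le> B * d" using t B0 by (intro mult_left_mono) auto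
    finally have "z t \<in> cball z0 e" using dB by (simp add: dist_commute)
    then show ?thesis by (simp add: H_def closest_point_self)
  qed
  have "(z has_vector_derivative G (z t)) (at t)" if t: "t \<in> {0<..<d}" for t
  proof -
    have "((\<lambda>u. integral {0..u} (\<lambda>s. H (z s))) has_vector_derivative H (z t)) (at t within {0..d})"
      using t by (intro integral_has_vector_derivative Hz) auto
    then have "((\<lambda>u. integral {0..u} (\<lambda>s. H (z s))) has_vector_derivative H (z t)) (at t)"
      using t by (simp add: at_within_Icc_at)
    then have "((\<lambda>u. z0 + integral {0..u} (\<lambda>s. H (z s))) has_vector_derivative G (z t)) (at t)"
      using HG[of t] t by (auto intro: derivative_eq_intros)
    then show ?thesis
      by (rule has_vector_derivative_transform_within_open[of _ _ _ "{0<..<d}"]) (use t z(2) in auto)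
  qed
  then show ?thesis
    using that[of d z] d z continuous_on_subset by force
qed

subsection \<open>A singular linear differential equation\<close>

text \<open>The exponential weight treats two situations at once: if \<open>A q > 0\<close>, this is
  uniqueness for a regular linear equation, and if \<open>A q = 0\<close>, the sign of
  \<open>R q\<close> does the work.\<close>

lemma linear_ode_zero_before:
  fixes W W' A R :: "real \<Rightarrow> real"
  assumes "p < q"
    and W: "\<And>s. s \<in> {p..q} \<Longrightarrow> (W has_real_derivative W' s) (at s)"
    and ode: "\<And>s. s \<in> {p..q} \<Longrightarrow> W' s * A s = W s * R s"
    and cont: "continuous_on {p..q} A" "continuous_on {p..q} R"
    and A: "\<And>s. s \<in> {p..<q} \<Longrightarrow> A s > 0" and R: "A q = 0 \<Longrightarrow> R q > 0"
    and "W q = 0"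
  shows "\<exists>s\<in>{p..<q}. W s = 0"
proof -
  have "A q \<ge> 0"
  proof -
    have "(A \<longlongrightarrow> A q) (at_left q)"
      using cont(1) \<open>p < q\<close> continuous_on_Icc_at_leftD by blast
    moreover have "\<forall>\<^sub>F s in at_left q. A s \<ge> 0"
      using eventually_at_left_real[OF \<open>p < q\<close>] by eventually_elim (use A in \<open>force intro: less_imp_le\<close>)
    ultimately show ?thesis by (rule tendsto_lowerbound) simp
  qed
  \<comment> \<open>The choice makes \<open>R + C * A\<close> positive at \<open>q\<close>, hence
    also shortly before it: for \<open>A q = 0\<close> because \<open>R q > 0\<close>, otherwise
    because the value is at least \<open>1\<close>.\<close>
  define C where "C = (if A q = 0 then 0 else (\<bar>R q\<bar> + 1) / A q)"
  have pos: "R q + C * A q > 0"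
    using R \<open>A q \<ge> 0\<close> by (auto simp: C_def)
  have "continuous_on {p..q} (\<lambda>s. R s + C * A s)"
    by (intro continuous_intros cont)
  then have "((\<lambda>s. R s + C * A s) \<longlongrightarrow> R q + C * A q) (at_left q)"
    using \<open>p < q\<close> continuous_on_Icc_at_leftD by blast
  then have "\<forall>\<^sub>F s in at_left q. R s + C * A s > 0"
    using pos order_tendstoD(1) by blast
  then obtain p' where p': "p' < q" "\<And>s. p' < s \<Longrightarrow> s < q \<Longrightarrow> R s + C * A s > 0"
    unfolding eventually_at_left_field by blast
  define m where "m = (max p p' + q) / 2"
  have m: "p \<le> m" "m < q" "p' < m" using \<open>p < q\<close> \<open>p' < q\<close> by (auto simp: m_def field_simps)
  define V where "V s = (W s)\<^sup>2 * exp (2 * C * s)" for s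
  have "V m \<le> V q"
  proof (rule DERIV_nonneg_imp_nondecreasing[of m q V])
    fix s assume s: "m \<le> s" "s \<le> q"
    have "(V has_real_derivative 2 * (W s * (W' s + C * W s)) * exp (2 * C * s)) (at s)"
      unfolding V_def using s m
      by (auto intro!: derivative_eq_intros W simp: power2_eq_square algebra_simps)
    moreover have "W s * (W' s + C * W s) \<ge> 0"
    proof (cases "s = q")
      case False
      then have sq: "s \<in> {p..<q}" using s m by auto
      \<comment> \<open>The factor \<open>A s > 0\<close> brings in the equation without affecting
        the sign. At \<open>q\<close>, where \<open>A\<close> may vanish, \<open>W q = 0\<close> is
        used instead.\<close>
      have "(W s * (W' s + C * W s)) * A s = (W s)\<^sup>2 * (R s + C * A s)"
        using ode[of s] sq by (simp add: power2_eq_square algebra_simps)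
      also have "\<dots> \<ge> 0" using p'(2)[of s] m s False by simp
      finally show ?thesis using A[OF sq] by (simp add: zero_le_mult_iff)
    qed (use \<open>W q = 0\<close> in simp)
    then have "2 * (W s * (W' s + C * W s)) * exp (2 * C * s) \<ge> 0" by simp
    ultimately show "\<exists>y. (V has_real_derivative y) (at s) \<and> 0 \<le> y" by blast
  qed (use m in simp)
  then have "W m = 0" using \<open>W q = 0\<close> by (simp add: V_def mult_le_0_iff not_le)
  then show ?thesis using m by auto
qed

text \<open>A nonzero value of \<open>W\<close> propagates, up to the next zero \<open>q\<close> of \<open>W\<close>, into a region where \<open>A > 0\<close>; there
  \<open>W\<^sup>2 exp (2 C s)\<close> is nondecreasing near \<open>q\<close> for suitable \<open>C\<close>, so it cannot tend to \<open>0\<close>.\<close>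

lemma linear_ode_zero_pos:
  fixes W W' A R :: "real \<Rightarrow> real"
  assumes W: "\<And>s. s \<in> {a..b} \<Longrightarrow> (W has_real_derivative W' s) (at s)"
    and ode: "\<And>s. s \<in> {a..b} \<Longrightarrow> W' s * A s = W s * R s"
    and cont: "continuous_on {a..b} A" "continuous_on {a..b} R"
    and R: "\<And>s. s \<in> {a..b} \<Longrightarrow> A s = 0 \<Longrightarrow> R s > 0"
    and "A b = 0" and x: "x \<in> {a..b}" "A x > 0"
  shows "W x = 0"
proof (rule ccontr)
  assume Wx: "W x \<noteq> 0"
  have W0: "W s = 0" if "s \<in> {a..b}" "A s = 0" for s
    using ode[of s] R[of s] that by auto
  define Z where "Z = {s \<in> {x..b}. W s = 0}"
  have "continuous_on {x..b} W"
    using W x by (meson DERIV_isCont atLeastatMost_subset_iff continuous_at_imp_continuous_on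
        order_refl subsetD atLeastAtMost_iff)
  then have "closed Z" unfolding Z_def
    using continuous_closed_preimage_constant[of "{x..b}" W 0] by simp
  moreover have "b \<in> Z" using W0[of b] \<open>A b = 0\<close> x by (auto simp: Z_def)
  moreover have "bdd_below Z" by (auto simp: Z_def)
  ultimately have qZ: "Inf Z \<in> Z" using closed_contains_Inf by blast
  define q where "q = Inf Z"
  have q: "x < q" "q \<le> b" "W q = 0" using qZ Wx by (auto simp: Z_def q_def less_le)
  have nz: "W s \<noteq> 0" if "s \<in> {x..<q}" for s
  proof
    assume "W s = 0"
    then have "s \<in> Z" using that q by (auto simp: Z_def)
    then have "q \<le> s" unfolding q_def using \<open>bdd_below Z\<close> cInf_lower by blast
    then show False using that by auto
  qed
  have cxq: "continuous_on {x..s} A" if "s \<le> q" for s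
    using cont(1) that x q by (auto elim: continuous_on_subset)
  have "\<exists>s\<in>{x..<q}. W s = 0"
  proof (rule linear_ode_zero_before[of x q W W' A R])
    fix s assume s: "s \<in> {x..<q}"
    show "A s > 0"
    proof (rule ccontr)
      assume "\<not> A s > 0"
      \<comment> \<open>If \<open>A\<close> lost its positivity before \<open>q\<close>, it would
        have a zero there; the equation would then force \<open>W = 0\<close>, although
        \<open>q\<close> is the first zero of \<open>W\<close> after \<open>x\<close>.\<close>
      then obtain r where "x \<le> r" "r \<le> s" "A r = 0"
        using IVT2'[of A s 0 x] x s cxq[of s] by auto
      then show False using nz[of r] W0[of r] s x q by auto
    qed
  qed (use x q W ode R cxq continuous_on_subset[OF cont(2)] in auto)
  then show False using nz by blast
qed

text \<open>The reflection of the line reverses the signs of both \<open>W'\<close> and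
  \<open>A\<close>. It thus preserves the equation and the sign of \<open>R\<close> and reduces a
  point with \<open>A < 0\<close> to one with \<open>A > 0\<close>, the endpoint \<open>a\<close>
  taking the role of \<open>b\<close>.\<close>

lemma linear_ode_zero:
  fixes W W' A R :: "real \<Rightarrow> real"
  assumes W: "\<And>s. s \<in> {a..b} \<Longrightarrow> (W has_real_derivative W' s) (at s)"
    and ode: "\<And>s. s \<in> {a..b} \<Longrightarrow> W' s * A s = W s * R s"
    and cont: "continuous_on {a..b} A" "continuous_on {a..b} R"
    and R: "\<And>s. s \<in> {a..b} \<Longrightarrow> A s = 0 \<Longrightarrow> R s > 0"
    and A: "A a = 0" "A b = 0" and x: "x \<in> {a..b}"
  shows "W x = 0"
proof -
  consider "A x = 0" | "A x > 0" | "A x < 0" by linarith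
  then show ?thesis
  proof cases
    case 1
    then show ?thesis using ode[OF x] R[OF x] by auto
  next
    case 2
    show ?thesis
      by (rule linear_ode_zero_pos[of a b W W' A R]) (fact W ode cont R A x 2)+
  next
    case 3
    have "W (- (- x)) = 0"
    proof (rule linear_ode_zero_pos[of "-b" "-a" "\<lambda>s. W (- s)" "\<lambda>s. - W' (- s)" "\<lambda>s. - A (- s)" "\<lambda>s. R (- s)" "-x"])
      show "((\<lambda>s. W (- s)) has_real_derivative - W' (- s)) (at s)" if "s \<in> {-b..-a}" for s
        by (rule DERIV_cong[OF DERIV_chain2[of W _ uminus, OF W]]) (use that in \<open>auto intro!: derivative_eq_intros\<close>)
      show "continuous_on {- b..- a} (\<lambda>s. - A (- s))"
        by (intro continuous_intros continuous_on_compose2[OF cont(1)]) auto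
      show "continuous_on {- b..- a} (\<lambda>s. R (- s))"
        by (intro continuous_intros continuous_on_compose2[OF cont(2)]) auto
    qed (use ode R A x 3 in auto)
    then show ?thesis by simp
  qed
qed

text \<open>\<open>g\<close> is the even part of \<open>\<phi>\<close>.  Multiplying the hypothesis by \<open>g\<close> and using \<open>g V = g'' W - g' W'\<close> gives an
  equation \<open>W' A = W R\<close>; at a zero of \<open>A\<close> inside \<open>[0, b)\<close> one has
  \<open>R (g - s g') = g (g - s g' + (b\<^sup>2 - s\<^sup>2) g'')\<close>, hence \<open>R > 0\<close> by ellipticity.\<close>

lemma calF_eq_0:
  fixes \<phi> :: "real \<Rightarrow> real"
  assumes b: "0 < b" "b < b0"
    and \<phi>: "smooth_on {-b0<..<b0} \<phi>" and pos: "\<And>s. s \<in> {-b0<..<b0} \<Longrightarrow> \<phi> s > 0"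
    and ell: "\<And>s r. \<bar>s\<bar> \<le> r \<Longrightarrow> r < b0 \<Longrightarrow>
        \<phi> s - s * deriv \<phi> s + (r\<^sup>2 - s\<^sup>2) * deriv (deriv \<phi>) s > 0"
    and eq: "\<And>s. s \<in> {0..b} \<Longrightarrow> calF \<phi> (b\<^sup>2) s = k * s * (b\<^sup>2 - s\<^sup>2) * calE \<phi> s"
    and s: "s \<in> {0..b}"
  shows "calF \<phi> (b\<^sup>2) s = 0"
proof -
  define D1 where "D1 = deriv \<phi>"
  define D2 where "D2 = deriv D1"
  let ?J = "{-b0<..<b0}"
  have sm: "smooth_on ?J D1" "smooth_on ?J D2"
    using smooth_on_deriv[of ?J] \<phi> by (auto simp: D1_def D2_def)
  have D: "(\<phi> has_real_derivative D1 s) (at s)" "(D1 has_real_derivative D2 s) (at s)" if "s \<in> ?J" for s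
    using smooth_on_DERIV[OF \<phi> that] smooth_on_DERIV[OF sm(1) that] by (auto simp: D1_def D2_def)
  have cont: "continuous_on T (\<lambda>s. f (- s))" "continuous_on T f"
    if "f \<in> {\<phi>, D1, D2}" "T \<subseteq> ?J" for f T
  proof -
    have f: "continuous_on ?J f" using that sm \<phi> smooth_on_imp_continuous_on by auto
    show "continuous_on T f" using f that(2) continuous_on_subset by blast
    show "continuous_on T (\<lambda>s. f (- s))"
      by (rule continuous_on_compose2[OF f]) (use that(2) in \<open>auto intro!: continuous_intros\<close>)
  qed
  define W where "W s = \<phi> (- s) * D1 s + \<phi> s * D1 (- s)" for s
  define W' where "W' s = \<phi> (- s) * D2 s - \<phi> s * D2 (- s)" for s
  define g where "g s = (\<phi> s + \<phi> (- s)) / 2" for s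
  define g1 where "g1 s = (D1 s - D1 (- s)) / 2" for s
  define g2 where "g2 s = (D2 s + D2 (- s)) / 2" for s
  define A where "A s = (b\<^sup>2 - s\<^sup>2) * (k * s * (g s - s * g1 s) + g1 s)" for s
  define R where "R s = g s + (b\<^sup>2 - s\<^sup>2) * g2 s * (1 - k * s\<^sup>2)" for s
  define V where "V s = D1 s * D2 (- s) + D1 (- s) * D2 s" for s
  have gV: "g s * V s = g2 s * W s - g1 s * W' s" for s
    by (simp add: g_def V_def g1_def g2_def W_def W'_def field_simps)
  have gpos: "g s > 0" if "s \<in> ?J" for s
    using pos[of s] pos[of "-s"] that by (auto simp: g_def)
  have E: "calE \<phi> s = s * V s + W' s" and F: "calF \<phi> (b\<^sup>2) s = (b\<^sup>2 - s\<^sup>2) * V s + W s" for s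
    by (simp_all add: calE_def calF_def V_def W'_def W_def D1_def D2_def)
  \<comment> \<open>This averages ellipticity at \<open>s\<close> and \<open>-s\<close>. It is used
    with \<open>r = s\<close>, giving \<open>g s - s * g1 s > 0\<close>, and with
    \<open>r = b\<close>.\<close>
  have ell': "g s - s * g1 s + (r\<^sup>2 - s\<^sup>2) * g2 s > 0" if "\<bar>s\<bar> \<le> r" "r < b0" for s r
    using ell[of s r] ell[of "-s" r] that
    by (simp add: g_def g1_def g2_def D1_def D2_def field_simps)
  have J: "{0..b} \<subseteq> ?J" using b by auto
  have WD: "(W has_real_derivative W' s) (at s)" if "s \<in> {0..b}" for s
  proof -
    have "((\<lambda>s. f (- s)) has_real_derivative f' (- s) * (- 1)) (at s)"
      if "(f has_real_derivative f' (- s)) (at (- s))" for f f'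
      by (rule DERIV_chain2[of f _ uminus, OF that]) (auto intro!: derivative_eq_intros)
    note this[of \<phi> D1, OF D(1)] this[of D1 D2, OF D(2)]
    with D[of s] show ?thesis
      unfolding W_def W'_def using that b
      by (auto intro!: derivative_eq_intros simp: algebra_simps)
  qed
  have W0: "W s = 0" if "s \<in> {0..b}" for s
  proof (rule linear_ode_zero[of 0 b W W' A R])
    show "(W has_real_derivative W' s) (at s)" if "s \<in> {0..b}" for s
      using WD[OF that] .
    show "W' s * A s = W s * R s" if "s \<in> {0..b}" for s
    proof -
      have "g s * ((b\<^sup>2 - s\<^sup>2) * V s + W s) = g s * (k * s * (b\<^sup>2 - s\<^sup>2) * (s * V s + W' s))"
        using eq[OF that] E F by simp
      then have "(b\<^sup>2 - s\<^sup>2) * (g s * V s) + g s * W s = k * s * (b\<^sup>2 - s\<^sup>2) * (s * (g s * V s) + g s * W' s)"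
        by (simp add: algebra_simps)
      then show ?thesis
        unfolding gV A_def R_def by (simp add: algebra_simps power2_eq_square)
    qed
    show "continuous_on {0..b} A" "continuous_on {0..b} R"
      unfolding A_def R_def g_def g1_def g2_def
      by (intro continuous_intros cont[of \<phi>] cont[of D1] cont[of D2] J; simp)+
    show "R s > 0" if s: "s \<in> {0..b}" "A s = 0" for s
    proof (cases "s = b")
      case True
      then show ?thesis using gpos[of b] b by (simp add: R_def)
    next
      case False
      then have "b\<^sup>2 - s\<^sup>2 > 0" using s by (simp add: power_strict_mono)
      then have ks: "k * s * (g s - s * g1 s) = - g1 s" using s False by (simp add: A_def)
      have "R s * (g s - s * g1 s) = g s * (g s - s * g1 s)
          + (b\<^sup>2 - s\<^sup>2) * g2 s * ((g s - s * g1 s) - s * (k * s * (g s - s * g1 s)))"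
        by (simp add: R_def algebra_simps power2_eq_square)
      also have "\<dots> = g s * (g s - s * g1 s + (b\<^sup>2 - s\<^sup>2) * g2 s)"
        unfolding ks by (simp add: algebra_simps)
      also have "\<dots> > 0" using gpos[of s] ell'[of s b] s b by (intro mult_pos_pos) auto
      finally show ?thesis
        using ell'[of s s] s b by (simp add: zero_less_mult_iff)
    qed
    \<comment> \<open>At \<open>0\<close> because \<open>g1\<close>, the derivative of an even
      function, is odd; at \<open>b\<close> because of the factor
      \<open>b\<^sup>2 - s\<^sup>2\<close>.\<close>
    show "A 0 = 0" "A b = 0" by (simp_all add: A_def g1_def)
  qed (use that in auto)
  \<comment> \<open>\<open>W\<close> is known to vanish on \<open>{0..b}\<close> only. Comparing
    derivatives within this interval covers its endpoints as well.\<close>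
  have "W' s = 0"
  proof -
    have "(W has_vector_derivative W' s) (at s within {0..b})"
      using WD[OF s] by (simp add: has_real_derivative_iff_has_vector_derivative
          has_vector_derivative_at_within)
    moreover have "(W has_vector_derivative 0) (at s within {0..b})"
      by (rule has_vector_derivative_transform[OF s, of _ "\<lambda>_. 0"]) (use W0 in auto)
    ultimately show ?thesis
      using vector_derivative_unique_within_closed_interval[OF b(1), of s W "W' s" 0] s
      unfolding cbox_interval by blast
  qed
  then have "V s = 0" using gV[of s] W0[OF s] gpos[of s] s J by auto
  then show ?thesis using F W0[OF s] by simp
qed

subsection \<open>Euler-Lagrange equations in isothermal coordinates\<close>

text \<open>\<open>EL1\<close>, \<open>EL2\<close> are the Euler-Lagrange expressions of \<open>(A \<phi>(s))\<^sup>2 / 2\<close> along a curve with velocity \<open>y\<close> and acceleration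
  \<open>z\<close>, with \<open>A = u \<bar>y\<bar>\<close>, \<open>n\<close> the gradient of \<open>\<nu>\<close> and \<open>bij = \<partial>\<^sub>i b\<^sub>j\<close>.  Pairing them with \<open>y\<close> gives the
  derivative of the energy, and pairing them with the rotated \<open>y\<close> gives the curvature equation.\<close>

lemma euler_lagrange_algebra:
  fixes y1 y2 z1 z2 b1 b2 n1 n2 b11 b12 b21 b22 u A A' s s' f f1 f2 :: real
  assumes pos: "A > 0" "u > 0" "f > 0"
    and A: "A\<^sup>2 = u\<^sup>2 * (y1\<^sup>2 + y2\<^sup>2)" and s: "b1 * y1 + b2 * y2 = s * A"
    and A': "A * A' = A\<^sup>2 * (n1 * y1 + n2 * y2) + u\<^sup>2 * (y1 * z1 + y2 * z2)"
    and s': "A * s' + s * A' = b1 * z1 + b2 * z2 + q"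
    and q: "q = y1 * (b11 * y1 + b12 * y2) + y2 * (b21 * y1 + b22 * y2)"
    and Q: "Q = f\<^sup>2 - s * f * f1" "Q1 = f * f1 - s * f1\<^sup>2 - s * f * f2"
    and R: "R = f * f1" "R1 = f1\<^sup>2 + f * f2"
    and P: "P = f - s * f1 + ((b2 * y1 - b1 * y2) / A)\<^sup>2 * f2"
    and EL1: "EL1 = 2 * (n1 * y1 + n2 * y2) * u\<^sup>2 * y1 * Q + u\<^sup>2 * z1 * Q + u\<^sup>2 * y1 * Q1 * s'
        + (A' * R + A * R1 * s') * b1 + A * R * (b11 * y1 + b21 * y2)
        - (A\<^sup>2 * n1 * Q + A * R * (b11 * y1 + b12 * y2))"
    and EL2: "EL2 = 2 * (n1 * y1 + n2 * y2) * u\<^sup>2 * y2 * Q + u\<^sup>2 * z2 * Q + u\<^sup>2 * y2 * Q1 * s'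
        + (A' * R + A * R1 * s') * b2 + A * R * (b12 * y1 + b22 * y2)
        - (A\<^sup>2 * n2 * Q + A * R * (b21 * y1 + b22 * y2))"
    and N: "N = A\<^sup>2 * (f - s * f1) * (n2 * y1 - n1 * y2)
        - f2 * (b2 * y1 - b1 * y2) * (q - s * A * (n1 * y1 + n2 * y2))
        - A * f1 * (y1\<^sup>2 + y2\<^sup>2) * (b12 - b21)"
  shows "EL1 = 0 \<and> EL2 = 0 \<longleftrightarrow> A' * f + A * f1 * s' = 0 \<and> u\<^sup>2 * P * (y1 * z2 - y2 * z1) = N"
proof -
  define \<rho> where "\<rho> = y1\<^sup>2 + y2\<^sup>2"
  define K where "K = y1 * z2 - y2 * z1"
  define \<beta> where "\<beta> = b2 * y1 - b1 * y2"
  define m where "m = n1 * y1 + n2 * y2"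
  have \<rho>: "\<rho> > 0" using A pos unfolding \<rho>_def
    by (metis mult_pos_pos zero_less_mult_pos zero_less_power)
  have 1: "y1 * EL1 + y2 * EL2 = A * f * (A' * f + A * f1 * s')"
  proof -
    have "y1 * EL1 + y2 * EL2 = 2 * m * (u\<^sup>2 * \<rho>) * Q + u\<^sup>2 * (y1 * z1 + y2 * z2) * Q + (u\<^sup>2 * \<rho>) * Q1 * s'
        + (A' * R + A * R1 * s') * (b1 * y1 + b2 * y2) - A\<^sup>2 * m * Q"
      unfolding EL1 EL2 \<rho>_def m_def by (simp add: algebra_simps power2_eq_square)
    also have "\<dots> = (A\<^sup>2 * m + u\<^sup>2 * (y1 * z1 + y2 * z2)) * Q + A\<^sup>2 * Q1 * s' + (A' * R + A * R1 * s') * (s * A)"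
      unfolding s \<rho>_def A[symmetric] by (simp add: algebra_simps)
    also have "\<dots> = A * f * (A' * f + A * f1 * s')"
      unfolding m_def A'[symmetric] Q R by (simp add: algebra_simps power2_eq_square)
    finally show ?thesis .
  qed
  \<comment> \<open>In the derivative of \<open>s\<close> the part of the acceleration along
    \<open>y\<close> cancels against \<open>A'\<close>. What remains is its transverse part, so
    \<open>s'\<close> depends on the acceleration only through \<open>K\<close>.\<close>
  have As': "\<rho> * (A * s') = \<beta> * K + \<rho> * (q - s * A * m)"
  proof -
    have "A * (\<rho> * (A * s')) = A * \<rho> * (b1 * z1 + b2 * z2 + q) - \<rho> * s * (A * A')"
    proof -
      have "A * s' = b1 * z1 + b2 * z2 + q - s * A'" using s' by simp
      then show ?thesis by (simp only:) (simp add: algebra_simps)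
    qed
    also have "\<dots> = A * \<rho> * (b1 * z1 + b2 * z2 + q) - \<rho> * s * A\<^sup>2 * m - s * (u\<^sup>2 * \<rho>) * (y1 * z1 + y2 * z2)"
      unfolding A' by (simp add: m_def algebra_simps)
    also have "u\<^sup>2 * \<rho> = A\<^sup>2" unfolding A \<rho>_def ..
    finally have "A * (\<rho> * (A * s')) = A * \<rho> * (b1 * z1 + b2 * z2 + q) - \<rho> * s * A\<^sup>2 * m - s * A\<^sup>2 * (y1 * z1 + y2 * z2)" .
    also have "\<dots> = A * (\<rho> * (b1 * z1 + b2 * z2) - (s * A) * (y1 * z1 + y2 * z2) + \<rho> * (q - s * A * m))"
      by (simp add: algebra_simps power2_eq_square)
    also have "\<rho> * (b1 * z1 + b2 * z2) - (s * A) * (y1 * z1 + y2 * z2) = \<beta> * K"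
      unfolding s[symmetric] \<beta>_def K_def \<rho>_def by (simp add: algebra_simps power2_eq_square)
    finally show ?thesis using pos by simp
  qed
  \<comment> \<open>Constancy of the speed enters here: the coefficient of \<open>b\<close> contains
    \<open>A' * f + A * f1 * s'\<close>, and once this is \<open>0\<close> only a term in
    \<open>A * s'\<close> is left, which \<open>As'\<close> expresses through
    \<open>K\<close>.\<close>
  have 2: "y1 * EL2 - y2 * EL1 = f * (u\<^sup>2 * P * K - N)" if E: "A' * f + A * f1 * s' = 0"
  proof -
    have "y1 * EL2 - y2 * EL1 = u\<^sup>2 * Q * K + (A' * R + A * R1 * s') * \<beta> + A * R * \<rho> * (b12 - b21)
        - A\<^sup>2 * Q * (n2 * y1 - n1 * y2)"
      unfolding EL1 EL2 \<rho>_def K_def \<beta>_def by (simp add: algebra_simps power2_eq_square)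
    also have "A' * R + A * R1 * s' = f * (f2 * (A * s')) + f1 * (A' * f + A * f1 * s')"
      unfolding R by (simp add: algebra_simps power2_eq_square)
    finally have *: "y1 * EL2 - y2 * EL1 = f * (u\<^sup>2 * (f - s * f1) * K + f2 * (A * s') * \<beta>
        + A * f1 * \<rho> * (b12 - b21) - A\<^sup>2 * (f - s * f1) * (n2 * y1 - n1 * y2))"
      unfolding E Q R by (simp add: algebra_simps power2_eq_square)
    have "A * s' = u\<^sup>2 * (\<beta> / A\<^sup>2) * K + (q - s * A * m)"
    proof -
      have "u\<^sup>2 * (\<beta> / A\<^sup>2) = \<beta> / \<rho>" using A pos by (simp add: \<rho>_def)
      moreover have "A * s' = \<beta> / \<rho> * K + (q - s * A * m)"
        using As' \<rho> by (simp add: field_simps)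
      ultimately show ?thesis by simp
    qed
    then have e: "f2 * (A * s') * \<beta> = u\<^sup>2 * (\<beta> / A)\<^sup>2 * f2 * K + f2 * \<beta> * (q - s * A * m)"
      by (simp only:) (simp add: power_divide power2_eq_square[of \<beta>] algebra_simps)
    show ?thesis
      unfolding * e P N \<beta>_def[symmetric] \<rho>_def[symmetric] m_def[symmetric]
      by (simp add: algebra_simps)
  qed
  \<comment> \<open>\<open>y\<close> and the rotated \<open>y\<close> form a basis because
    \<open>\<rho> > 0\<close>.\<close>
  have 3: "EL1 = 0 \<and> EL2 = 0 \<longleftrightarrow> y1 * EL1 + y2 * EL2 = 0 \<and> y1 * EL2 - y2 * EL1 = 0"
  proof -
    have "\<rho> * EL1 = y1 * (y1 * EL1 + y2 * EL2) - y2 * (y1 * EL2 - y2 * EL1)"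
      "\<rho> * EL2 = y2 * (y1 * EL1 + y2 * EL2) + y1 * (y1 * EL2 - y2 * EL1)"
      by (simp_all add: \<rho>_def algebra_simps power2_eq_square)
    then show ?thesis using \<rho> by (auto simp: zero_less_mult_iff)
  qed
  show ?thesis
    unfolding 3 using 1 2 pos by (auto simp: K_def)
qed

lemma partial_deriv_eqI:
  "(f has_derivative D) (at x) \<Longrightarrow> partial_deriv i f x = D (axis i 1)"
  by (simp add: partial_deriv_def frechet_derivative_at[symmetric])

lemma vec2_eq: "v = v $ 1 *\<^sub>R axis 1 1 + v $ 2 *\<^sub>R axis 2 (1::real)" for v :: "real^2"
  by (simp add: vec_eq_iff forall_2 axis_def)

lemma has_derivative_partial:
  assumes "(f has_derivative D) (at x)"
  shows "D = (\<lambda>v. partial_deriv 1 f x * v $ 1 + partial_deriv 2 f x * v $ 2)"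
proof
  fix v :: "real^2"
  interpret D: bounded_linear D using assms by (rule has_derivative_bounded_linear)
  have "D v = D (v $ 1 *\<^sub>R axis 1 1 + v $ 2 *\<^sub>R axis 2 1)" by (simp only: vec2_eq[symmetric])
  then show "D v = partial_deriv 1 f x * v $ 1 + partial_deriv 2 f x * v $ 2"
    by (simp add: D.add D.scale partial_deriv_eqI[OF assms])
qed

lemma DERIV_along_path:
  fixes f :: "real^2 \<Rightarrow> real"
  assumes "(f has_derivative D) (at (c r))" "(c has_vector_derivative y) (at r)"
  shows "((\<lambda>r. f (c r)) has_real_derivative
    partial_deriv 1 f (c r) * y $ 1 + partial_deriv 2 f (c r) * y $ 2) (at r)"
  using vector_derivative_diff_chain_within[OF assms(2) has_derivative_at_withinI[OF assms(1)]]
  by (simp add: has_derivative_partial[OF assms(1)] o_def has_real_derivative_iff_has_vector_derivative)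

lemma DERIV_nth:
  fixes y :: "real \<Rightarrow> real^'n"
  assumes "(y has_vector_derivative z) (at r)"
  shows "((\<lambda>r. y r $ i) has_real_derivative z $ i) (at r)"
  using bounded_linear.has_vector_derivative[OF bounded_linear_vec_nth assms]
  by (simp add: has_real_derivative_iff_has_vector_derivative)

lemma DERIV_norm_path:
  fixes y :: "real \<Rightarrow> 'a::real_inner"
  assumes "(y has_vector_derivative z) (at r)" "y r \<noteq> 0"
  shows "((\<lambda>r. norm (y r)) has_real_derivative (y r \<bullet> z) / norm (y r)) (at r)"
  using vector_derivative_diff_chain_within[OF assms(1)
      has_derivative_at_withinI[OF has_derivative_norm[OF assms(2)]]]
  by (simp add: o_def has_real_derivative_iff_has_vector_derivative sgn_div_norm inner_commute
      divide_inverse mult.commute)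

text \<open>\<open>A\<close> and \<open>B\<close> stand for \<alpha> and \<beta>, and
  \<open>w\<close> for either the velocity or the base point, so a single chain rule serves both
  \<open>momentum\<close> and \<open>force\<close>.\<close>

lemma has_derivative_half_square:
  fixes A B :: "'a::real_normed_vector \<Rightarrow> real" and \<phi> :: "real \<Rightarrow> real"
  assumes A: "(A has_derivative A') (at w)" and B: "(B has_derivative B') (at w)" and "A w \<noteq> 0"
    and f: "(\<phi> has_real_derivative f1) (at s)" and s: "s = B w / A w"
  shows "((\<lambda>w. (A w * \<phi> (B w / A w))\<^sup>2 / 2) has_derivative
      (\<lambda>h. A' h * (A w * ((\<phi> s)\<^sup>2 - s * \<phi> s * f1)) + B' h * (A w * (\<phi> s * f1)))) (at w)"
proof -
  have "((\<lambda>w. B w / A w) has_derivative (\<lambda>h. (B' h * A w - B w * A' h) / (A w * A w))) (at w)"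
    by (rule has_derivative_divide'[OF B A \<open>A w \<noteq> 0\<close>])
  from has_derivative_compose[OF this f[unfolded s has_field_derivative_def]]
  have "((\<lambda>w. \<phi> (B w / A w)) has_derivative
      (\<lambda>h. f1 * ((B' h * A w - B w * A' h) / (A w * A w)))) (at w)" .
  from has_derivative_mult[OF A this]
  have G: "((\<lambda>w. A w * \<phi> (B w / A w)) has_derivative
      (\<lambda>h. A w * (f1 * ((B' h * A w - B w * A' h) / (A w * A w))) + A' h * \<phi> s)) (at w)"
    unfolding s .
  have "((\<lambda>v. v\<^sup>2 / 2) has_real_derivative A w * \<phi> s) (at (A w * \<phi> (B w / A w)))"
    unfolding s by (auto intro!: derivative_eq_intros)
  from has_derivative_compose[OF G this[unfolded has_field_derivative_def]]
  show ?thesis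
  proof (rule has_derivative_eq_rhs)
    have "A w * \<phi> s * (A w * (f1 * ((B' h * A w - B w * A' h) / (A w * A w))) + A' h * \<phi> s)
      = A' h * (A w * ((\<phi> s)\<^sup>2 - s * \<phi> s * f1)) + B' h * (A w * (\<phi> s * f1))" for h
    proof -
      have "A w * (f1 * ((B' h * A w - B w * A' h) / (A w * A w))) = f1 * (B' h - s * A' h)"
        using \<open>A w \<noteq> 0\<close> by (simp add: s field_simps)
      then show ?thesis by (simp only:) (simp add: algebra_simps power2_eq_square)
    qed
    then show "(\<lambda>h. A w * \<phi> s * (A w * (f1 * ((B' h * A w - B w * A' h) / (A w * A w))) + A' h * \<phi> s))
      = (\<lambda>h. A' h * (A w * ((\<phi> s)\<^sup>2 - s * \<phi> s * f1)) + B' h * (A w * (\<phi> s * f1)))"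
      by blast
  qed
qed

text \<open>The value of \<open>y\<^sub>1 z\<^sub>2 - y\<^sub>2 z\<^sub>1\<close> along a geodesic with velocity \<open>y\<close> and acceleration \<open>z\<close>.\<close>

definition turning ::
  "(real^2 \<Rightarrow> real) \<Rightarrow> (real^2 \<Rightarrow> real^2) \<Rightarrow> (real \<Rightarrow> real) \<Rightarrow> real^2 \<Rightarrow> real^2 \<Rightarrow> real" where
  "turning \<nu> b \<phi> x y =
    (let A = exp (\<nu> x) * norm y; s = (b x \<bullet> y) / A;
         p = b x $ 2 * y $ 1 - b x $ 1 * y $ 2;
         q = y $ 1 * (partial_deriv 1 (\<lambda>x. b x $ 1) x * y $ 1 + partial_deriv 1 (\<lambda>x. b x $ 2) x * y $ 2)
           + y $ 2 * (partial_deriv 2 (\<lambda>x. b x $ 1) x * y $ 1 + partial_deriv 2 (\<lambda>x. b x $ 2) x * y $ 2)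
     in (A\<^sup>2 * (\<phi> s - s * deriv \<phi> s) * (partial_deriv 2 \<nu> x * y $ 1 - partial_deriv 1 \<nu> x * y $ 2)
         - deriv (deriv \<phi>) s * p * (q - s * A * (partial_deriv 1 \<nu> x * y $ 1 + partial_deriv 2 \<nu> x * y $ 2))
         - A * deriv \<phi> s * ((y $ 1)\<^sup>2 + (y $ 2)\<^sup>2) * curl21 b x)
        / ((exp (\<nu> x))\<^sup>2 * (\<phi> s - s * deriv \<phi> s + (p / A)\<^sup>2 * deriv (deriv \<phi>) s)))"

text \<open>The metric survives only through \<open>exp (\<nu> x)\<close>. The assumptions are
  stable under replacing \<open>b\<close> by \<open>- b\<close>, so that every result can be used
  for the reverse norm too.\<close>

locale conformal_alpha_beta =
  fixes U :: "(real^2) set" and \<nu> :: "real^2 \<Rightarrow> real" and b :: "real^2 \<Rightarrow> real^2"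
    and b0 :: real and \<phi> :: "real \<Rightarrow> real" and F :: "real^2 \<Rightarrow> real^2 \<Rightarrow> real"
  assumes open_U: "open U" and smooth_nu: "smooth_on U \<nu>" and smooth_b: "smooth_on U b"
    and smooth_phi: "smooth_on {-b0<..<b0} \<phi>" and phi_pos: "\<And>s. s \<in> {-b0<..<b0} \<Longrightarrow> \<phi> s > 0"
    and elliptic: "\<And>s r. \<bar>s\<bar> \<le> r \<Longrightarrow> r < b0 \<Longrightarrow>
        \<phi> s - s * deriv \<phi> s + (r\<^sup>2 - s\<^sup>2) * deriv (deriv \<phi>) s > 0"
    and norm_b: "\<And>x. x \<in> U \<Longrightarrow> norm (b x) / exp (\<nu> x) < b0"
    and F_eq: "\<And>x y. x \<in> U \<Longrightarrow> y \<noteq> 0 \<Longrightarrow>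
        F x y = exp (\<nu> x) * norm y * \<phi> ((b x \<bullet> y) / (exp (\<nu> x) * norm y))"
begin

abbreviation "A x y \<equiv> exp (\<nu> x) * norm y"
abbreviation "S x y \<equiv> (b x \<bullet> y) / A x y"
abbreviation "\<phi>1 \<equiv> deriv \<phi>"
abbreviation "\<phi>2 \<equiv> deriv (deriv \<phi>)"
abbreviation "Q s \<equiv> (\<phi> s)\<^sup>2 - s * \<phi> s * \<phi>1 s"
abbreviation "R s \<equiv> \<phi> s * \<phi>1 s"
abbreviation "n i x \<equiv> partial_deriv i \<nu> x"
abbreviation "db i j x \<equiv> partial_deriv i (\<lambda>x. b x $ j) x"
abbreviation "P x y \<equiv> \<phi> (S x y) - S x y * \<phi>1 (S x y)
  + ((b x $ 2 * y $ 1 - b x $ 1 * y $ 2) / A x y)\<^sup>2 * \<phi>2 (S x y)"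

lemma S_bound:
  assumes "y \<noteq> 0" shows "\<bar>S x y\<bar> \<le> norm (b x) / exp (\<nu> x)"
proof -
  have "\<bar>S x y\<bar> = \<bar>b x \<bullet> y\<bar> / (exp (\<nu> x) * norm y)"
    by (simp add: abs_mult)
  also have "\<dots> \<le> norm (b x) * norm y / (exp (\<nu> x) * norm y)"
    by (intro divide_right_mono Cauchy_Schwarz_ineq2) simp
  finally show ?thesis using assms by simp
qed

lemma S_in:
  assumes "x \<in> U" "y \<noteq> 0" shows "S x y \<in> {-b0<..<b0}"
proof -
  have "\<bar>S x y\<bar> < b0"
    by (rule le_less_trans[OF S_bound[OF assms(2)] norm_b[OF assms(1)]])
  then show ?thesis unfolding greaterThanLessThan_iff by linarith
qed

lemma Lagrange_2: "(b x \<bullet> y)\<^sup>2 + (b x $ 2 * y $ 1 - b x $ 1 * y $ 2)\<^sup>2 = (norm (b x))\<^sup>2 * (norm y)\<^sup>2"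
  by (simp add: power2_norm_eq_inner inner_vec_def sum_2) (simp add: power2_eq_square algebra_simps)

text \<open>Lagrange's identity turns the square in \<open>P\<close> into
  \<open>b\<^sup>2 - s\<^sup>2\<close>, so \<open>P\<close> is the expression of the ellipticity
  hypothesis at \<open>r = norm (b x) / exp (\<nu> x)\<close>.\<close>

lemma P_pos:
  assumes "x \<in> U" "y \<noteq> 0" shows "P x y > 0"
proof -
  let ?u = "exp (\<nu> x)" and ?p = "b x $ 2 * y $ 1 - b x $ 1 * y $ 2"
  have "((norm (b x)) / ?u)\<^sup>2 - (S x y)\<^sup>2 = (?p / A x y)\<^sup>2"
    using Lagrange_2[of x y] assms(2) by (simp add: power_divide power_mult_distrib field_simps)
  then show ?thesis
    using elliptic[OF S_bound[OF assms(2)] norm_b[OF assms(1)]] by simp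
qed

lemma F_pos: "x \<in> U \<Longrightarrow> y \<noteq> 0 \<Longrightarrow> F x y > 0"
  using S_in[of x y] phi_pos by (simp add: F_eq)

lemma F_scale: "x \<in> U \<Longrightarrow> y \<noteq> 0 \<Longrightarrow> k > 0 \<Longrightarrow> F x (k *\<^sub>R y) = k * F x y"
  by (simp add: F_eq)

lemma smooth_b_nth: "smooth_on U (\<lambda>x. b x $ j)"
  by (rule smooth_on_bounded_linear[OF open_U bounded_linear_vec_nth smooth_b])

lemma smooth_phi1: "smooth_on {-b0<..<b0} \<phi>1" and smooth_phi2: "smooth_on {-b0<..<b0} \<phi>2"
  using smooth_on_deriv[of "{-b0<..<b0}"] smooth_phi by auto

lemma phi_DERIV:
  assumes "s \<in> {-b0<..<b0}"
  shows "(\<phi> has_real_derivative \<phi>1 s) (at s)" "(\<phi>1 has_real_derivative \<phi>2 s) (at s)"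
  using smooth_on_DERIV[OF smooth_phi assms] smooth_on_DERIV[OF smooth_phi1 assms] by auto

lemma momentum:
  assumes "x \<in> U" "y \<noteq> 0"
  shows "partial_deriv i (\<lambda>y. energy F x y) y =
    (exp (\<nu> x))\<^sup>2 * y $ i * Q (S x y) + A x y * R (S x y) * b x $ i"
proof -
  have "((\<lambda>y. A x y) has_derivative (\<lambda>h. exp (\<nu> x) * (h \<bullet> sgn y))) (at y)"
    by (rule has_derivative_mult_right[OF has_derivative_norm[OF assms(2)]])
  moreover have "((\<lambda>y. b x \<bullet> y) has_derivative (\<lambda>h. b x \<bullet> h)) (at y)"
    by (auto intro!: derivative_eq_intros)
  ultimately have "((\<lambda>y. (A x y * \<phi> (S x y))\<^sup>2 / 2) has_derivative
      (\<lambda>h. exp (\<nu> x) * (h \<bullet> sgn y) * (A x y * Q (S x y)) + (b x \<bullet> h) * (A x y * R (S x y)))) (at y)"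
    using assms by (intro has_derivative_half_square phi_DERIV S_in) auto
  then have "((\<lambda>y. energy F x y) has_derivative
      (\<lambda>h. exp (\<nu> x) * (h \<bullet> sgn y) * (A x y * Q (S x y)) + (b x \<bullet> h) * (A x y * R (S x y)))) (at y)"
    by (rule has_derivative_transform_within_open[of _ _ _ _ "- {0}"])
      (use assms in \<open>auto simp: energy_def F_eq\<close>)
  from partial_deriv_eqI[OF this, of i] show ?thesis
    using assms(2) by (simp add: inner_axis inner_axis' sgn_div_norm power2_eq_square)
qed

lemma force:
  assumes "x \<in> U" "y \<noteq> 0"
  shows "partial_deriv i (\<lambda>x. energy F x y) x =
    (A x y)\<^sup>2 * n i x * Q (S x y) + A x y * R (S x y) * (db i 1 x * y $ 1 + db i 2 x * y $ 2)"
proof -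
  have \<nu>: "(\<nu> has_derivative frechet_derivative \<nu> (at x)) (at x)"
    by (rule smooth_on_has_derivative[OF smooth_nu assms(1)])
  have bj: "((\<lambda>x. b x $ j) has_derivative frechet_derivative (\<lambda>x. b x $ j) (at x)) (at x)" for j
    by (rule smooth_on_has_derivative[OF smooth_b_nth assms(1)])
  have "((\<lambda>x. A x y) has_derivative (\<lambda>h. frechet_derivative \<nu> (at x) h * A x y)) (at x)"
    by (rule derivative_eq_intros \<nu> refl | simp add: fun_eq_iff)+
  moreover have "((\<lambda>x. b x \<bullet> y) has_derivative (\<lambda>h. frechet_derivative (\<lambda>x. b x $ 1) (at x) h * y $ 1
      + frechet_derivative (\<lambda>x. b x $ 2) (at x) h * y $ 2)) (at x)"
    unfolding inner_vec_def sum_2 inner_real_def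
    by (rule derivative_eq_intros bj refl | simp add: fun_eq_iff)+
  ultimately have "((\<lambda>x. (A x y * \<phi> (S x y))\<^sup>2 / 2) has_derivative
      (\<lambda>h. frechet_derivative \<nu> (at x) h * A x y * (A x y * Q (S x y))
        + (frechet_derivative (\<lambda>x. b x $ 1) (at x) h * y $ 1
          + frechet_derivative (\<lambda>x. b x $ 2) (at x) h * y $ 2) * (A x y * R (S x y)))) (at x)"
    using assms by (intro has_derivative_half_square phi_DERIV S_in) auto
  then have "((\<lambda>x. energy F x y) has_derivative
      (\<lambda>h. frechet_derivative \<nu> (at x) h * A x y * (A x y * Q (S x y))
        + (frechet_derivative (\<lambda>x. b x $ 1) (at x) h * y $ 1
          + frechet_derivative (\<lambda>x. b x $ 2) (at x) h * y $ 2) * (A x y * R (S x y)))) (at x)"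
    by (rule has_derivative_transform_within_open[OF _ open_U assms(1)])
      (use assms in \<open>auto simp: energy_def F_eq\<close>)
  from partial_deriv_eqI[OF this, of i] show ?thesis
    unfolding partial_deriv_def[symmetric]
    by (simp only: power2_eq_square ring_distribs mult_ac)
qed

lemma path_DERIVs:
  assumes c: "(c has_vector_derivative y r) (at r)" and y: "(y has_vector_derivative z) (at r)"
    and r: "c r \<in> U" "y r \<noteq> 0"
  defines "A' \<equiv> A (c r) (y r) * (n 1 (c r) * y r $ 1 + n 2 (c r) * y r $ 2)
      + exp (\<nu> (c r)) * (y r \<bullet> z) / norm (y r)"
    and "B' \<equiv> b (c r) \<bullet> z + (y r $ 1 * (db 1 1 (c r) * y r $ 1 + db 1 2 (c r) * y r $ 2)
      + y r $ 2 * (db 2 1 (c r) * y r $ 1 + db 2 2 (c r) * y r $ 2))"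
  shows "((\<lambda>r. A (c r) (y r)) has_real_derivative A') (at r)"
    "((\<lambda>r. S (c r) (y r)) has_real_derivative (B' - S (c r) (y r) * A') / A (c r) (y r)) (at r)"
    "((\<lambda>r. exp (\<nu> (c r))) has_real_derivative
        exp (\<nu> (c r)) * (n 1 (c r) * y r $ 1 + n 2 (c r) * y r $ 2)) (at r)"
    "((\<lambda>r. b (c r) $ j) has_real_derivative db 1 j (c r) * y r $ 1 + db 2 j (c r) * y r $ 2) (at r)"
proof -
  have d\<nu>: "((\<lambda>r. \<nu> (c r)) has_real_derivative n 1 (c r) * y r $ 1 + n 2 (c r) * y r $ 2) (at r)"
    by (rule DERIV_along_path[OF smooth_on_has_derivative[OF smooth_nu r(1)] c])
  have bj: "((\<lambda>r. b (c r) $ j) has_real_derivative db 1 j (c r) * y r $ 1 + db 2 j (c r) * y r $ 2) (at r)" for j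
    by (rule DERIV_along_path[OF smooth_on_has_derivative[OF smooth_b_nth r(1)] c])
  show "((\<lambda>r. b (c r) $ j) has_real_derivative db 1 j (c r) * y r $ 1 + db 2 j (c r) * y r $ 2) (at r)"
    by (rule bj)
  show e: "((\<lambda>r. exp (\<nu> (c r))) has_real_derivative
        exp (\<nu> (c r)) * (n 1 (c r) * y r $ 1 + n 2 (c r) * y r $ 2)) (at r)"
    by (rule derivative_eq_intros d\<nu> refl)+
  show dA: "((\<lambda>r. A (c r) (y r)) has_real_derivative A') (at r)"
    unfolding A'_def
    by (rule DERIV_cong[OF DERIV_mult[OF e DERIV_norm_path[OF y r(2)]]]) (simp add: algebra_simps)
  have dB: "((\<lambda>r. b (c r) \<bullet> y r) has_real_derivative B') (at r)"
    unfolding inner_vec_def sum_2 inner_real_def B'_def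
    by (rule derivative_eq_intros bj DERIV_nth[OF y] refl)+ (simp add: algebra_simps)
  show "((\<lambda>r. S (c r) (y r)) has_real_derivative (B' - S (c r) (y r) * A') / A (c r) (y r)) (at r)"
    by (rule DERIV_cong[OF DERIV_divide[OF dB dA]]) (use r in \<open>auto simp: field_simps\<close>)
qed

end

lemma DERIV_iff_eq:
  "(f has_field_derivative a) (at x) \<Longrightarrow> (f has_field_derivative e) (at x) \<longleftrightarrow> a = e"
  using DERIV_unique by blast

lemma norm_sq_2: "(norm y)\<^sup>2 = (y $ 1)\<^sup>2 + (y $ 2)\<^sup>2" for y :: "real^2"
  by (simp only: power2_norm_eq_inner inner_vec_def sum_2) (simp add: power2_eq_square)

text \<open>These are the clauses of \<open>geodesic\<close> that do not mention the norm, hence the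
  common ground for curves of different norms.\<close>

definition regular_path :: "(real^2) set \<Rightarrow> real set \<Rightarrow> (real \<Rightarrow> real^2) \<Rightarrow> bool" where
  "regular_path U I c \<longleftrightarrow>
     open I \<and> is_interval I \<and> I \<noteq> {} \<and> c ` I \<subseteq> U \<and> Ck_on 2 I c \<and>
     (\<forall>r\<in>I. vector_derivative c (at r) \<noteq> 0)"

text \<open>This is Euclidean curvature times the cube of Euclidean speed.\<close>

definition velocity_det :: "(real \<Rightarrow> real^2) \<Rightarrow> real \<Rightarrow> real" where
  "velocity_det c r =
    (let y = (\<lambda>r. vector_derivative c (at r)); z = vector_derivative y (at r)
     in y r $ 1 * z $ 2 - y r $ 2 * z $ 1)"

context conformal_alpha_beta
begin

context
  fixes I :: "real set" and c y z :: "real \<Rightarrow> real^2"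
  assumes I: "open I" and cU: "\<And>r. r \<in> I \<Longrightarrow> c r \<in> U" and y0: "\<And>r. r \<in> I \<Longrightarrow> y r \<noteq> 0"
    and c: "\<And>r. r \<in> I \<Longrightarrow> (c has_vector_derivative y r) (at r)"
    and y: "\<And>r. r \<in> I \<Longrightarrow> (y has_vector_derivative z r) (at r)"
begin

definition A_rate where "A_rate r = A (c r) (y r) * (n 1 (c r) * y r $ 1 + n 2 (c r) * y r $ 2)
      + exp (\<nu> (c r)) * (y r \<bullet> z r) / norm (y r)"
definition b_rate where "b_rate r = y r $ 1 * (db 1 1 (c r) * y r $ 1 + db 1 2 (c r) * y r $ 2)
      + y r $ 2 * (db 2 1 (c r) * y r $ 1 + db 2 2 (c r) * y r $ 2)"
definition S_rate where "S_rate r = (b (c r) \<bullet> z r + b_rate r - S (c r) (y r) * A_rate r) / A (c r) (y r)"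

lemma phi_path_DERIVs:
  assumes "r \<in> I"
  shows "((\<lambda>r. \<phi> (S (c r) (y r))) has_real_derivative \<phi>1 (S (c r) (y r)) * S_rate r) (at r)"
    "((\<lambda>r. \<phi>1 (S (c r) (y r))) has_real_derivative \<phi>2 (S (c r) (y r)) * S_rate r) (at r)"
proof -
  have S: "((\<lambda>r. S (c r) (y r)) has_real_derivative S_rate r) (at r)"
    using path_DERIVs(2)[of c y r "z r", OF c y cU y0] assms unfolding S_rate_def A_rate_def b_rate_def by blast
  show "((\<lambda>r. \<phi> (S (c r) (y r))) has_real_derivative \<phi>1 (S (c r) (y r)) * S_rate r) (at r)"
    "((\<lambda>r. \<phi>1 (S (c r) (y r))) has_real_derivative \<phi>2 (S (c r) (y r)) * S_rate r) (at r)"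
    using assms by (auto intro!: DERIV_chain2[OF _ S] phi_DERIV simp only: S_in[OF cU y0])
qed

lemma speed_DERIV:
  assumes "r \<in> I"
  shows "((\<lambda>r. F (c r) (y r)) has_real_derivative
    A_rate r * \<phi> (S (c r) (y r)) + A (c r) (y r) * \<phi>1 (S (c r) (y r)) * S_rate r) (at r)"
proof -
  have A: "((\<lambda>r. A (c r) (y r)) has_real_derivative A_rate r) (at r)"
    using path_DERIVs(1)[of c y r "z r", OF c y cU y0] assms unfolding A_rate_def by blast
  have "((\<lambda>r. A (c r) (y r) * \<phi> (S (c r) (y r))) has_real_derivative
    A_rate r * \<phi> (S (c r) (y r)) + A (c r) (y r) * \<phi>1 (S (c r) (y r)) * S_rate r) (at r)"
    by (rule DERIV_cong[OF DERIV_mult[OF A phi_path_DERIVs(1)[OF assms]]]) (simp add: algebra_simps)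
  then show ?thesis
    by (rule has_field_derivative_transform_within_open[OF _ I assms]) (simp add: F_eq cU y0)
qed

text \<open>The change to unit speed has a second derivative involving the derivative of the speed;
  its continuity makes that change \<open>Ck_on 2\<close>.\<close>

lemma speed_C1:
  assumes "continuous_on I z"
  shows "continuous_on I (\<lambda>r. A_rate r * \<phi> (S (c r) (y r)) + A (c r) (y r) * \<phi>1 (S (c r) (y r)) * S_rate r)"
proof -
  have cc: "continuous_on I c" and cy: "continuous_on I y"
    by (rule continuous_at_imp_continuous_on, rule ballI, rule has_vector_derivative_continuous,
        erule c y)+
  have U: "continuous_on I (\<lambda>r. f (c r))" if "smooth_on U f" for f :: "real^2 \<Rightarrow> real"
    by (rule continuous_on_compose2[OF smooth_on_imp_continuous_on[OF that] cc]) (use cU in auto)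
  have bc: "continuous_on I (\<lambda>r. b (c r))"
    by (rule continuous_on_compose2[OF smooth_on_imp_continuous_on[OF smooth_b] cc]) (use cU in auto)
  have d: "continuous_on I (\<lambda>r. n i (c r))" "continuous_on I (\<lambda>r. db i j (c r))" for i j
    unfolding partial_deriv_def
    by (intro U smooth_on_frechet_derivative smooth_nu smooth_b_nth)+
  have S: "continuous_on I (\<lambda>r. S (c r) (y r))"
    by (intro continuous_intros U smooth_nu bc cy) (use y0 in auto)
  have f: "continuous_on I (\<lambda>r. \<phi> (S (c r) (y r)))" "continuous_on I (\<lambda>r. \<phi>1 (S (c r) (y r)))"
    by (rule continuous_on_compose2[OF smooth_on_imp_continuous_on S], rule smooth_phi smooth_phi1,
        use S_in[OF cU y0] in blast)+
  have Ac: "continuous_on I A_rate"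
    unfolding A_rate_def by (intro continuous_intros U smooth_nu d cy assms) (use y0 in auto)
  show ?thesis
    unfolding S_rate_def b_rate_def
    by (intro continuous_intros U smooth_nu Ac d bc cy f S assms) (use y0 in auto)
qed

text \<open>The tangential equation is the vanishing of the derivative found in
  \<open>speed_DERIV\<close>. Ellipticity makes the factor of the determinant in the transverse
  equation positive, so dividing by it gives \<open>turning\<close>.\<close>

lemma euler_lagrange_iff:
  assumes r: "r \<in> I"
  shows "(\<forall>i. ((\<lambda>r. partial_deriv i (\<lambda>y. energy F (c r) y) (y r)) has_real_derivative
        partial_deriv i (\<lambda>x. energy F x (y r)) (c r)) (at r)) \<longleftrightarrow>
    ((\<lambda>r. F (c r) (y r)) has_real_derivative 0) (at r) \<and>
    y r $ 1 * z r $ 2 - y r $ 2 * z r $ 1 = turning \<nu> b \<phi> (c r) (y r)"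
proof -
  let ?u = "exp (\<nu> (c r))" and ?A = "A (c r) (y r)" and ?s = "S (c r) (y r)"
  let ?m = "n 1 (c r) * y r $ 1 + n 2 (c r) * y r $ 2"
  let ?f = "\<phi> ?s" and ?f1 = "\<phi>1 ?s" and ?f2 = "\<phi>2 ?s"
  let ?Q1 = "?f * ?f1 - ?s * ?f1\<^sup>2 - ?s * ?f * ?f2"
  let ?R1 = "?f1\<^sup>2 + ?f * ?f2"
  let ?b = "\<lambda>i. b (c r) $ i"
  let ?p' = "\<lambda>i. 2 * ?m * ?u\<^sup>2 * y r $ i * Q ?s + ?u\<^sup>2 * z r $ i * Q ?s + ?u\<^sup>2 * y r $ i * ?Q1 * S_rate r
        + (A_rate r * R ?s + ?A * ?R1 * S_rate r) * ?b i + ?A * R ?s * (db 1 i (c r) * y r $ 1 + db 2 i (c r) * y r $ 2)"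
  let ?E = "\<lambda>i. ?A\<^sup>2 * n i (c r) * Q ?s + ?A * R ?s * (db i 1 (c r) * y r $ 1 + db i 2 (c r) * y r $ 2)"
  note cr = cU[OF r] and yr = y0[OF r]
  note pd = path_DERIVs[of c y r "z r", OF c[OF r] y[OF r] cr yr,
      folded b_rate_def A_rate_def, folded S_rate_def]
  have p': "((\<lambda>r. partial_deriv i (\<lambda>y. energy F (c r) y) (y r)) has_real_derivative ?p' i) (at r)" for i
  proof -
    have "((\<lambda>r. (exp (\<nu> (c r)))\<^sup>2 * y r $ i * Q (S (c r) (y r)) + A (c r) (y r) * R (S (c r) (y r)) * b (c r) $ i)
        has_real_derivative ?p' i) (at r)"
      by (rule derivative_eq_intros pd(1) pd(2) pd(3) pd(4) phi_path_DERIVs r DERIV_nth[OF y] refl)+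
        (simp add: power2_eq_square algebra_simps)
    then show ?thesis
      by (rule has_field_derivative_transform_within_open[OF _ I r]) (simp only: momentum[OF cU y0])
  qed
  \<comment> \<open>The momentum has derivative \<open>?p' i\<close> along any such path, so by
    uniqueness of derivatives the Euler-Lagrange equations become numerical identities.\<close>
  have "(\<forall>i. ((\<lambda>r. partial_deriv i (\<lambda>y. energy F (c r) y) (y r)) has_real_derivative
        partial_deriv i (\<lambda>x. energy F x (y r)) (c r)) (at r)) \<longleftrightarrow> (\<forall>i. ?p' i = ?E i)"
    unfolding force[OF cr yr] DERIV_iff_eq[OF p'] ..
  also have "\<dots> \<longleftrightarrow> ?p' 1 - ?E 1 = 0 \<and> ?p' 2 - ?E 2 = 0"
    unfolding forall_2 by simp
  also have "\<dots> \<longleftrightarrow> A_rate r * ?f + ?A * ?f1 * S_rate r = 0 \<and>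
    ?u\<^sup>2 * P (c r) (y r) * (y r $ 1 * z r $ 2 - y r $ 2 * z r $ 1) =
      ?A\<^sup>2 * (?f - ?s * ?f1) * (n 2 (c r) * y r $ 1 - n 1 (c r) * y r $ 2)
        - ?f2 * (?b 2 * y r $ 1 - ?b 1 * y r $ 2) * (b_rate r - ?s * ?A * ?m)
        - ?A * ?f1 * ((y r $ 1)\<^sup>2 + (y r $ 2)\<^sup>2) * (db 1 2 (c r) - db 2 1 (c r))"
  proof (rule euler_lagrange_algebra[OF _ _ _ _ _ _ _ b_rate_def refl refl refl refl refl refl refl refl])
    show "?A > 0" "?u > 0" using yr by auto
    show "?f > 0" using phi_pos S_in[OF cr yr] by blast
    show "?A\<^sup>2 = ?u\<^sup>2 * ((y r $ 1)\<^sup>2 + (y r $ 2)\<^sup>2)"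
      by (simp add: power_mult_distrib norm_sq_2)
    show "?b 1 * y r $ 1 + ?b 2 * y r $ 2 = ?s * ?A"
      using yr by (simp add: inner_vec_def sum_2)
    show "?A * A_rate r = ?A\<^sup>2 * ?m + ?u\<^sup>2 * (y r $ 1 * z r $ 1 + y r $ 2 * z r $ 2)"
      using yr by (simp add: A_rate_def inner_vec_def sum_2 field_simps power2_eq_square)
    show "?A * S_rate r + ?s * A_rate r = ?b 1 * z r $ 1 + ?b 2 * z r $ 2 + b_rate r"
      using yr by (simp add: S_rate_def inner_vec_def sum_2)
  qed
  also have "A_rate r * ?f + ?A * ?f1 * S_rate r = 0 \<longleftrightarrow> ((\<lambda>r. F (c r) (y r)) has_real_derivative 0) (at r)"
    unfolding DERIV_iff_eq[OF speed_DERIV[OF r]] ..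
  finally show ?thesis
    using P_pos[OF cr yr] unfolding turning_def Let_def b_rate_def curl21_def
    by (simp add: eq_divide_eq mult.commute)
qed

end

lemma geodesic_iff:
  "geodesic U F I c \<longleftrightarrow> regular_path U I c \<and>
    (\<forall>r\<in>I. ((\<lambda>r. F (c r) (vector_derivative c (at r))) has_real_derivative 0) (at r) \<and>
      velocity_det c r = turning \<nu> b \<phi> (c r) (vector_derivative c (at r)))"
proof (cases "regular_path U I c")
  case True
  let ?y = "\<lambda>r. vector_derivative c (at r)"
  let ?z = "\<lambda>r. vector_derivative ?y (at r)"
  have I: "open I" "Ck_on 2 I c" "c ` I \<subseteq> U" "\<And>r. r \<in> I \<Longrightarrow> ?y r \<noteq> 0"
    using True by (auto simp: regular_path_def)
  note D = Ck_on_2_realD[OF I(1,2)]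
  have "c r \<in> U" if "r \<in> I" for r using I(3) that by auto
  note EL = euler_lagrange_iff[OF I(1) this I(4) D(1,2)]
  have "geodesic U F I c \<longleftrightarrow> (\<forall>r\<in>I. \<forall>i.
        ((\<lambda>r. partial_deriv i (\<lambda>y. energy F (c r) y) (?y r)) has_real_derivative
         partial_deriv i (\<lambda>x. energy F x (?y r)) (c r)) (at r))"
    using True unfolding geodesic_def regular_path_def by simp
  also have "\<dots> \<longleftrightarrow> (\<forall>r\<in>I. ((\<lambda>r. F (c r) (?y r)) has_real_derivative 0) (at r) \<and>
      velocity_det c r = turning \<nu> b \<phi> (c r) (?y r))"
    unfolding velocity_det_def Let_def by (intro ball_cong refl EL)
  finally show ?thesis using True by simp
next
  case False
  then show ?thesis unfolding geodesic_def regular_path_def by blast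
qed

lemma speed_continuously_differentiable:
  assumes "regular_path U I c"
  obtains g where "continuous_on I g"
    "\<And>r. r \<in> I \<Longrightarrow> ((\<lambda>r. F (c r) (vector_derivative c (at r))) has_real_derivative g r) (at r)"
proof -
  let ?y = "\<lambda>r. vector_derivative c (at r)"
  let ?z = "\<lambda>r. vector_derivative ?y (at r)"
  have I: "open I" "Ck_on 2 I c" "c ` I \<subseteq> U" "\<And>r. r \<in> I \<Longrightarrow> ?y r \<noteq> 0"
    using assms by (auto simp: regular_path_def)
  note D = Ck_on_2_realD[OF I(1,2)]
  have "c r \<in> U" if "r \<in> I" for r using I(3) that by auto
  note prem = I(1) this I(4) D(1,2)
  show ?thesis
    by (rule that[OF speed_C1[OF prem D(3)] speed_DERIV[OF prem]])
qed

end

section \<open>Unit directions and the regularity of the turning function\<close>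

definition dir :: "real \<Rightarrow> real^2" where
  "dir \<theta> = cos \<theta> *\<^sub>R axis 1 1 + sin \<theta> *\<^sub>R axis 2 1"

lemma dir_nth [simp]: "dir \<theta> $ 1 = cos \<theta>" "dir \<theta> $ 2 = sin \<theta>"
  by (simp_all add: dir_def axis_def)

lemma norm_dir [simp]: "norm (dir \<theta>) = 1"
  using norm_sq_2[of "dir \<theta>"] by (simp add: power2_eq_1_iff) (use norm_ge_zero[of "dir \<theta>"] in linarith)

lemma dir_nonzero [simp]: "dir \<theta> \<noteq> 0"
  using norm_dir[of \<theta>] by (metis norm_zero zero_neq_one)

lemma inner_dir: "v \<bullet> dir \<theta> = v $ 1 * cos \<theta> + v $ 2 * sin \<theta>"
  by (simp add: inner_vec_def sum_2)

lemma polar_dir: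
  fixes y :: "real^2"
  obtains \<theta> where "0 \<le> \<theta>" "\<theta> < 2 * pi" "y = norm y *\<^sub>R dir \<theta>"
proof (cases "y = 0")
  case True
  then show ?thesis using that[of 0] by simp
next
  case False
  have "(y $ 1 / norm y)\<^sup>2 + (y $ 2 / norm y)\<^sup>2 = 1"
    unfolding power_divide add_divide_distrib[symmetric] norm_sq_2[symmetric] using False by simp
  then obtain \<theta> where \<theta>: "0 \<le> \<theta>" "\<theta> < 2 * pi"
    and cs: "y $ 1 / norm y = cos \<theta>" "y $ 2 / norm y = sin \<theta>"
    using sincos_total_2pi by blast
  have "y = norm y *\<^sub>R dir \<theta>"
    unfolding vec_eq_iff forall_2 vector_scaleR_component dir_nth cs[symmetric] using False by simp
  then show ?thesis using that \<theta> by blast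
qed

lemma dir_has_vector_derivative:
  assumes "(f has_real_derivative f') (at r)"
  shows "((\<lambda>r. dir (f r)) has_vector_derivative f' *\<^sub>R dir (f r + pi / 2)) (at r)"
proof -
  have "((\<lambda>r. cos (f r)) has_real_derivative - sin (f r) * f') (at r)"
    "((\<lambda>r. sin (f r)) has_real_derivative cos (f r) * f') (at r)"
    using assms by (auto intro!: derivative_eq_intros)
  then have "((\<lambda>r. dir (f r)) has_vector_derivative
      (- sin (f r) * f') *\<^sub>R axis 1 1 + (cos (f r) * f') *\<^sub>R axis 2 1) (at r)"
    unfolding dir_def
    by (intro has_vector_derivative_add has_vector_derivative_scaleR[OF _ has_vector_derivative_const, simplified])
  moreover have "(- sin (f r) * f') *\<^sub>R axis 1 1 + (cos (f r) * f') *\<^sub>R axis 2 1 = f' *\<^sub>R dir (f r + pi / 2)"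
    by (simp add: vec_eq_iff forall_2 axis_def cos_add sin_add)
  ultimately show ?thesis by simp
qed

lemma continuous_on_dir [continuous_intros]:
  "continuous_on T f \<Longrightarrow> continuous_on T (\<lambda>r. dir (f r))" for T :: "'a::t2_space set"
  unfolding dir_def by (intro continuous_intros)

lemma lipschitz_near_cos_sin: "lipschitz_near cos (t::real)" "lipschitz_near sin (t::real)"
  by (rule lipschitz_near_DERIV[of UNIV _ _ "\<lambda>x. - sin x"]; auto intro!: derivative_eq_intros continuous_intros)
    (rule lipschitz_near_DERIV[of UNIV _ _ cos]; auto intro!: derivative_eq_intros continuous_intros)

lemma lipschitz_near_snd_cos_sin:
  "lipschitz_near (\<lambda>w. cos (snd w)) (p :: 'a::real_normed_vector \<times> real)"
  "lipschitz_near (\<lambda>w. sin (snd w)) (p :: 'a::real_normed_vector \<times> real)"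
  by (rule lipschitz_near_compose[of snd], rule lipschitz_near_bounded_linear, rule bounded_linear_snd,
      rule lipschitz_near_cos_sin)+

lemma lipschitz_near_dir: "lipschitz_near (\<lambda>w. dir (snd w)) (p :: 'a::real_normed_vector \<times> real)"
  unfolding dir_def
  by (intro lipschitz_near_add lipschitz_near_compose[OF lipschitz_near_snd_cos_sin(1)]
      lipschitz_near_compose[OF lipschitz_near_snd_cos_sin(2)]
      lipschitz_near_bounded_linear bounded_linear_scaleR_left)

text \<open>The quantities \<open>s\<close> and \<open>p / A\<close> have degree 0 in the velocity,
  and each summand of the numerator has degree 3.\<close>

lemma turning_scale:
  assumes "y \<noteq> 0" "k > 0"
  shows "turning \<nu> b \<phi> x (k *\<^sub>R y) = k ^ 3 * turning \<nu> b \<phi> x y"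
proof -
  have s: "(b x \<bullet> (k *\<^sub>R y)) / (exp (\<nu> x) * norm (k *\<^sub>R y)) = (b x \<bullet> y) / (exp (\<nu> x) * norm y)"
    using assms by simp
  have p: "(b x $ 2 * (k *\<^sub>R y) $ 1 - b x $ 1 * (k *\<^sub>R y) $ 2) / (exp (\<nu> x) * norm (k *\<^sub>R y))
      = (b x $ 2 * y $ 1 - b x $ 1 * y $ 2) / (exp (\<nu> x) * norm y)"
    using assms by (simp add: field_simps)
  show ?thesis
    unfolding turning_def Let_def s p times_divide_eq_right
    by (rule arg_cong2[where f = "(/)"])
      (use assms in \<open>simp_all add: algebra_simps power2_eq_square power3_eq_cube\<close>)
qed

text \<open>Squares are spelled out as products to match \<open>lipschitz_near_intros\<close>, whose
  rules cover products and quotients but not powers.\<close>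

lemma turning_dir:
  "turning \<nu> b \<phi> x (dir \<theta>) =
    (let c = cos \<theta>; s = sin \<theta>; u = exp (\<nu> x); S = (b x $ 1 * c + b x $ 2 * s) / u;
         p = b x $ 2 * c - b x $ 1 * s;
         q = c * (partial_deriv 1 (\<lambda>x. b x $ 1) x * c + partial_deriv 1 (\<lambda>x. b x $ 2) x * s)
           + s * (partial_deriv 2 (\<lambda>x. b x $ 1) x * c + partial_deriv 2 (\<lambda>x. b x $ 2) x * s)
     in (u * u * (\<phi> S - S * deriv \<phi> S) * (partial_deriv 2 \<nu> x * c - partial_deriv 1 \<nu> x * s)
         - deriv (deriv \<phi>) S * p * (q - S * u * (partial_deriv 1 \<nu> x * c + partial_deriv 2 \<nu> x * s))
         - u * deriv \<phi> S * curl21 b x)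
        / (u * u * (\<phi> S - S * deriv \<phi> S + (p / u) * (p / u) * deriv (deriv \<phi>) S)))"
  unfolding turning_def Let_def by (simp add: inner_dir power2_eq_square flip: power2_eq_square)

context conformal_alpha_beta
begin

lemma lipschitz_turning:
  assumes "x \<in> U"
  shows "lipschitz_near (\<lambda>w. turning \<nu> b \<phi> (fst w) (dir (snd w))) (x, \<theta>)"
proof -
  let ?p = "(x, \<theta>)"
  have U: "lipschitz_near (\<lambda>w. f (fst w)) ?p" if "smooth_on U f" for f :: "real^2 \<Rightarrow> real"
    by (rule lipschitz_near_compose[OF lipschitz_near_bounded_linear[OF bounded_linear_fst]
          lipschitz_near_smooth[OF open_U _ that]]) (use assms in simp)
  have d: "lipschitz_near (\<lambda>w. n i (fst w)) ?p" "lipschitz_near (\<lambda>w. db i j (fst w)) ?p" for i j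
    unfolding partial_deriv_def by (intro U smooth_on_frechet_derivative smooth_nu smooth_b_nth)+
  have curl: "lipschitz_near (\<lambda>w. curl21 b (fst w)) ?p"
    unfolding curl21_def by (intro lipschitz_near_intros d)
  have exp: "lipschitz_near (\<lambda>w. exp (\<nu> (fst w))) ?p"
    by (rule lipschitz_near_compose[OF U[OF smooth_nu]],
        rule lipschitz_near_DERIV[of UNIV _ _ exp]) (auto intro!: derivative_eq_intros continuous_intros)
  note leaf = U[OF smooth_b_nth] d curl exp lipschitz_near_snd_cos_sin
  let ?S = "\<lambda>w. (b (fst w) $ 1 * cos (snd w) + b (fst w) $ 2 * sin (snd w)) / exp (\<nu> (fst w))"
  have S: "lipschitz_near ?S ?p" by (intro lipschitz_near_intros leaf) simp
  have Sx: "?S ?p \<in> {-b0<..<b0}" using S_in[OF assms dir_nonzero[of \<theta>]] by (simp add: inner_dir)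
  have f: "lipschitz_near (\<lambda>w. f (?S w)) ?p" if "smooth_on {-b0<..<b0} f" for f :: "real \<Rightarrow> real"
    by (rule lipschitz_near_compose[OF S lipschitz_near_smooth[OF _ Sx that]]) simp
  show ?thesis
    unfolding turning_dir Let_def
  proof (intro lipschitz_near_intros leaf S f smooth_phi smooth_phi1 smooth_phi2)
    show "exp (\<nu> (fst ?p)) * exp (\<nu> (fst ?p)) * (\<phi> (?S ?p) - ?S ?p * \<phi>1 (?S ?p)
       + ((b (fst ?p) $ 2 * cos (snd ?p) - b (fst ?p) $ 1 * sin (snd ?p)) / exp (\<nu> (fst ?p)))
         * ((b (fst ?p) $ 2 * cos (snd ?p) - b (fst ?p) $ 1 * sin (snd ?p)) / exp (\<nu> (fst ?p)))
         * \<phi>2 (?S ?p)) \<noteq> 0"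
      using P_pos[OF assms dir_nonzero[of \<theta>]] by (simp add: inner_dir power2_eq_square)
  qed simp_all
qed

end

subsection \<open>Reparametrization and projective equivalence\<close>

lemma velocity_det_eq:
  assumes "open I" "r \<in> I" "\<And>r. r \<in> I \<Longrightarrow> (c has_vector_derivative y r) (at r)"
    "(y has_vector_derivative z) (at r)"
  shows "velocity_det c r = y r $ 1 * z $ 2 - y r $ 2 * z $ 1"
proof -
  have y: "vector_derivative c (at r) = y r" if "r \<in> I" for r
    using assms(3)[OF that] vector_derivative_at by blast
  have "((\<lambda>r. vector_derivative c (at r)) has_vector_derivative z) (at r)"
    by (rule has_vector_derivative_transform_within_open[OF assms(4,1,2)]) (simp add: y)
  then show ?thesis
    unfolding velocity_det_def Let_def y[OF assms(2)] by (simp add: vector_derivative_at)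
qed

lemma reparametrization_DERIVs:
  fixes c :: "real \<Rightarrow> 'a::real_normed_vector" and h :: "real \<Rightarrow> real"
  assumes "(h has_real_derivative h1 w) (at w)" "(h1 has_real_derivative h2) (at w)"
    and "(c has_vector_derivative y (h w)) (at (h w))" "(y has_vector_derivative z) (at (h w))"
  shows "((\<lambda>w. c (h w)) has_vector_derivative h1 w *\<^sub>R y (h w)) (at w)"
    "((\<lambda>w. h1 w *\<^sub>R y (h w)) has_vector_derivative (h1 w)\<^sup>2 *\<^sub>R z + h2 *\<^sub>R y (h w)) (at w)"
proof -
  have chain: "((\<lambda>w. g (h w)) has_vector_derivative h1 w *\<^sub>R g') (at w)"
    if "(g has_vector_derivative g') (at (h w))" for g :: "real \<Rightarrow> 'a" and g'
    using vector_diff_chain_at[of h "h1 w" w g g'] that assms(1)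
    by (simp add: o_def has_real_derivative_iff_has_vector_derivative)
  show "((\<lambda>w. c (h w)) has_vector_derivative h1 w *\<^sub>R y (h w)) (at w)"
    by (rule chain[OF assms(3)])
  have "((\<lambda>w. h1 w *\<^sub>R y (h w)) has_vector_derivative h1 w *\<^sub>R h1 w *\<^sub>R z + h2 *\<^sub>R y (h w)) (at w)"
    by (rule has_vector_derivative_scaleR[OF assms(2) chain[OF assms(4)]])
  then show "((\<lambda>w. h1 w *\<^sub>R y (h w)) has_vector_derivative (h1 w)\<^sup>2 *\<^sub>R z + h2 *\<^sub>R y (h w)) (at w)"
    by (simp add: power2_eq_square)
qed

text \<open>The interval may be unbounded on either side; describing it by endpoints in the extended
  reals makes \<open>einterval_antiderivative\<close> applicable.\<close>

lemma antiderivative_open_interval: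
  fixes f :: "real \<Rightarrow> real"
  assumes "open I" "is_interval I" "I \<noteq> {}" "continuous_on I f"
  obtains G where "\<And>x. x \<in> I \<Longrightarrow> (G has_real_derivative f x) (at x)"
proof -
  define l where "l = Inf (ereal ` I)"
  define u where "u = Sup (ereal ` I)"
  have between: "l < ereal x \<and> ereal x < u \<longleftrightarrow> x \<in> I" for x
  proof
    assume "l < ereal x \<and> ereal x < u"
    then obtain p q where "p \<in> I" "q \<in> I" "p < x" "x < q"
      by (auto simp: l_def u_def Inf_less_iff less_Sup_iff)
    then show "x \<in> I" using assms(2) mem_is_interval_1_I[of I p q x] by auto
  next
    assume "x \<in> I"
    then obtain e where "e > 0" "cball x e \<subseteq> I" using assms(1) open_contains_cball by blast
    then have "x - e \<in> I" "x + e \<in> I" "x - e < x" "x < x + e" by (auto simp: subset_eq dist_real_def)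
    then show "l < ereal x \<and> ereal x < u"
      unfolding l_def u_def Inf_less_iff less_Sup_iff by (metis imageI less_ereal.simps(1))
  qed
  obtain x0 where "x0 \<in> I" using assms(3) by blast
  then have "l < u" using between less_trans by blast
  moreover have "isCont f x" if "l < ereal x" "ereal x < u" for x
    using that between assms(1,4) continuous_on_eq_continuous_at by blast
  ultimately show ?thesis
    using einterval_antiderivative[of l u f] that between
    by (auto simp: has_real_derivative_iff_has_vector_derivative)
qed

text \<open>This is arc length parametrization with speed \<open>e\<close>: \<open>h\<close> inverts
  an antiderivative of \<open>e\<close>, so its derivative \<open>1 / e (h w)\<close> normalizes the
  speed to \<open>1\<close>.\<close>

lemma inverse_of_antiderivative:
  fixes e g :: "real \<Rightarrow> real"
  assumes I: "open I" "is_interval I" "I \<noteq> {}"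
    and e: "\<And>r. r \<in> I \<Longrightarrow> e r > 0" "\<And>r. r \<in> I \<Longrightarrow> (e has_real_derivative g r) (at r)"
    and g: "continuous_on I g"
  obtains J h where "open J" "is_interval J" "J \<noteq> {}" "h ` J = I" "Ck_on 2 J h"
    "\<And>w. w \<in> J \<Longrightarrow> (h has_real_derivative 1 / e (h w)) (at w)"
    "\<And>w. w \<in> J \<Longrightarrow> ((\<lambda>w. 1 / e (h w)) has_real_derivative - g (h w) / e (h w) ^ 3) (at w)"
    "continuous_on J (\<lambda>w. - g (h w) / e (h w) ^ 3)"
proof -
  have ec: "continuous_on I e"
    using e(2) DERIV_isCont continuous_at_imp_continuous_on by blast
  obtain H where H: "\<And>r. r \<in> I \<Longrightarrow> (H has_real_derivative e r) (at r)"
    using antiderivative_open_interval[OF I ec] by blast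
  have mono: "H p < H q" if "p \<in> I" "q \<in> I" "p < q" for p q
  proof (rule DERIV_pos_imp_increasing[OF that(3)])
    fix r assume "p \<le> r" "r \<le> q"
    then have "r \<in> I" using mem_is_interval_1_I[OF I(2) that(1,2)] by blast
    then show "\<exists>y. (H has_real_derivative y) (at r) \<and> 0 < y" using H e(1) by blast
  qed
  then have inj: "inj_on H I" by (metis inj_onI linorder_neqE_linordered_idom order_less_irrefl)
  have Hc: "continuous_on I H"
    using H DERIV_isCont continuous_at_imp_continuous_on by blast
  define J where "J = H ` I"
  define h where "h = the_inv_into I H"
  have hH: "h (H r) = r" if "r \<in> I" for r using inj that by (simp add: h_def the_inv_into_f_f)
  have J: "open J" unfolding J_def by (rule invariance_of_domain[OF Hc I(1) inj])
  have J': "is_interval J" unfolding J_def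
    using connected_continuous_image[OF Hc] I(2) by (simp add: is_interval_connected_1)
  have hJ: "h ` J = I" using hH by (auto simp: J_def image_iff)
  have hI: "h w \<in> I" if "w \<in> J" for w using hJ that by blast
  have dh: "(h has_real_derivative 1 / e (h w)) (at w)" if "w \<in> J" for w
  proof -
    obtain r where r: "r \<in> I" "w = H r" using \<open>w \<in> J\<close> unfolding J_def by blast
    have "(h has_real_derivative inverse (e r)) (at (H r))"
      unfolding has_field_derivative_def
      by (rule has_derivative_inverse_strong[OF I(1) r(1) Hc hH H[OF r(1), unfolded has_field_derivative_def]])
        (use e(1)[OF r(1)] in \<open>auto simp: fun_eq_iff\<close>)
    then show ?thesis using r hH by (simp add: inverse_eq_divide)
  qed
  have d2: "((\<lambda>w. 1 / e (h w)) has_real_derivative - g (h w) / e (h w) ^ 3) (at w)" if "w \<in> J" for w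
  proof -
    have "((\<lambda>w. e (h w)) has_real_derivative g (h w) * (1 / e (h w))) (at w)"
      by (rule DERIV_chain2[OF e(2)[OF hI[OF that]] dh[OF that]])
    then have "((\<lambda>w. 1 / e (h w)) has_real_derivative
        (0 * e (h w) - 1 * (g (h w) * (1 / e (h w)))) / (e (h w) * e (h w))) (at w)"
      using e(1)[OF hI[OF that]] by (intro DERIV_divide DERIV_const) auto
    then show ?thesis
      by (rule DERIV_cong) (simp add: power3_eq_cube)
  qed
  have hc: "continuous_on J h"
    using dh DERIV_isCont continuous_at_imp_continuous_on by blast
  have c2: "continuous_on J (\<lambda>w. - g (h w) / e (h w) ^ 3)"
    by (intro continuous_intros continuous_on_compose2[OF g hc] continuous_on_compose2[OF ec hc])
      (use hJ hI e(1) in force)+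
  have "Ck_on 2 J h"
    by (rule Ck_on_2_realI[OF J dh[unfolded has_real_derivative_iff_has_vector_derivative]
          d2[unfolded has_real_derivative_iff_has_vector_derivative] c2])
  then show ?thesis using that[OF J J' _ hJ _ dh d2 c2] I(3) by (auto simp: J_def)
qed

text \<open>For \<open>d = c \<circ> h\<close> the acceleration gains a multiple of the velocity,
  which the determinant ignores; both sides of the turning equation are multiplied by the cube of
  the derivative of \<open>h\<close>. Every point of \<open>c\<close> is reached since
  \<open>h\<close> is onto.\<close>

lemma turning_transfer:
  fixes \<kappa> :: "real^2 \<Rightarrow> real^2 \<Rightarrow> real"
  assumes scale: "\<And>x y k. x \<in> U \<Longrightarrow> y \<noteq> 0 \<Longrightarrow> k > 0 \<Longrightarrow> \<kappa> x (k *\<^sub>R y) = k ^ 3 * \<kappa> x y"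
    and c: "regular_path U I c" and J: "open J" and cd: "same_oriented_curve I c J d"
    and d: "\<And>w. w \<in> J \<Longrightarrow> velocity_det d w = \<kappa> (d w) (vector_derivative d (at w))"
    and r: "r \<in> I"
  shows "velocity_det c r = \<kappa> (c r) (vector_derivative c (at r))"
proof -
  obtain h where h: "Ck_on 2 J h" "\<And>w. w \<in> J \<Longrightarrow> deriv h w > 0" "h ` J = I" "\<And>w. w \<in> J \<Longrightarrow> d w = c (h w)"
    using cd unfolding same_oriented_curve_def by blast
  obtain w where w: "w \<in> J" "h w = r" using h(3) r by blast
  have I: "open I" "Ck_on 2 I c" "c ` I \<subseteq> U" "\<And>r. r \<in> I \<Longrightarrow> vector_derivative c (at r) \<noteq> 0"
    using c by (auto simp: regular_path_def)
  note Dc = Ck_on_2_realD[OF I(1,2)]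
  note Dh = Ck_on_2_realD[OF J h(1)]
  define y where "y = (\<lambda>r. vector_derivative c (at r))"
  define z where "z = vector_derivative y (at r)"
  define h1 where "h1 = (\<lambda>w. vector_derivative h (at w))"
  define h2 where "h2 = vector_derivative h1 (at w)"
  have h1: "h1 w > 0" using h(2)[OF w(1)] Dh(1)[OF w(1)] unfolding h1_def
    by (metis DERIV_imp_deriv has_real_derivative_iff_has_vector_derivative)
  have d1: "(d has_vector_derivative h1 w *\<^sub>R y (h w)) (at w)" if "w \<in> J" for w
  proof (rule has_vector_derivative_transform_within_open[OF _ J that])
    have "h w \<in> I" using h(3) that by blast
    then show "((\<lambda>w. c (h w)) has_vector_derivative h1 w *\<^sub>R y (h w)) (at w)"
      using reparametrization_DERIVs(1)[of h h1 w _ c y] Dh(1,2)[OF that] Dc(1,2)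
      unfolding h1_def y_def has_real_derivative_iff_has_vector_derivative by blast
  qed (simp add: h(4))
  have d2: "((\<lambda>w. h1 w *\<^sub>R y (h w)) has_vector_derivative (h1 w)\<^sup>2 *\<^sub>R z + h2 *\<^sub>R y (h w)) (at w)"
    using reparametrization_DERIVs(2)[of h h1 w h2 c y z] Dh(1,2)[OF w(1)] Dc(1,2)[OF r] w(2)
    unfolding h1_def y_def z_def h2_def has_real_derivative_iff_has_vector_derivative by blast
  have "velocity_det d w = (h1 w *\<^sub>R y (h w)) $ 1 * ((h1 w)\<^sup>2 *\<^sub>R z + h2 *\<^sub>R y (h w)) $ 2
      - (h1 w *\<^sub>R y (h w)) $ 2 * ((h1 w)\<^sup>2 *\<^sub>R z + h2 *\<^sub>R y (h w)) $ 1"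
    by (rule velocity_det_eq[OF J w(1) d1 d2])
  also have "\<dots> = h1 w ^ 3 * (y r $ 1 * z $ 2 - y r $ 2 * z $ 1)"
    by (simp add: w(2) algebra_simps power2_eq_square power3_eq_cube)
  also have "y r $ 1 * z $ 2 - y r $ 2 * z $ 1 = velocity_det c r"
    by (simp add: velocity_det_def y_def z_def Let_def)
  finally have "h1 w ^ 3 * velocity_det c r = \<kappa> (d w) (vector_derivative d (at w))"
    using d[OF w(1)] by simp
  also have "vector_derivative d (at w) = h1 w *\<^sub>R y r"
    using d1[OF w(1)] w(2) vector_derivative_at by blast
  also have "\<kappa> (d w) (h1 w *\<^sub>R y r) = h1 w ^ 3 * \<kappa> (c r) (y r)"
    using scale[of "c r" "y r" "h1 w"] h1 I(3,4) r w h(4)[OF w(1)] by (auto simp: y_def)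
  finally show ?thesis using h1 by (simp add: y_def)
qed

text \<open>This isolates what the comparison of unparametrized geodesics uses, with the transverse
  equation as an abstract cubic function \<open>\<kappa>\<close>. The instances are \<open>F\<close>
  and its reverse.\<close>

locale path_geometry =
  fixes U :: "(real^2) set" and F \<kappa> :: "real^2 \<Rightarrow> real^2 \<Rightarrow> real"
  assumes open_domain: "open U"
    and geodesic_eq: "\<And>I c. geodesic U F I c \<longleftrightarrow> regular_path U I c \<and>
      (\<forall>r\<in>I. ((\<lambda>r. F (c r) (vector_derivative c (at r))) has_real_derivative 0) (at r) \<and>
        velocity_det c r = \<kappa> (c r) (vector_derivative c (at r)))"
    and speed_pos: "\<And>x y. x \<in> U \<Longrightarrow> y \<noteq> 0 \<Longrightarrow> F x y > 0"
    and speed_scale: "\<And>x y k. x \<in> U \<Longrightarrow> y \<noteq> 0 \<Longrightarrow> k > 0 \<Longrightarrow> F x (k *\<^sub>R y) = k * F x y"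
    and turn_scale: "\<And>x y k. x \<in> U \<Longrightarrow> y \<noteq> 0 \<Longrightarrow> k > 0 \<Longrightarrow> \<kappa> x (k *\<^sub>R y) = k ^ 3 * \<kappa> x y"
    and speed_C1: "\<And>I c. regular_path U I c \<Longrightarrow> \<exists>g. continuous_on I g \<and>
      (\<forall>r\<in>I. ((\<lambda>r. F (c r) (vector_derivative c (at r))) has_real_derivative g r) (at r))"
    and turn_lipschitz: "\<And>x \<theta>. x \<in> U \<Longrightarrow> lipschitz_near (\<lambda>w. \<kappa> (fst w) (dir (snd w))) (x, \<theta>)"
begin

text \<open>Passing to unit \<open>F\<close>-speed makes the speed equation true and keeps the
  turning equation, whose two sides scale alike.\<close>

lemma reparametrize:
  assumes c: "regular_path U I c"
    and turn: "\<And>r. r \<in> I \<Longrightarrow> velocity_det c r = \<kappa> (c r) (vector_derivative c (at r))"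
  obtains J d where "geodesic U F J d" "same_oriented_curve I c J d"
proof -
  define y where "y = (\<lambda>r. vector_derivative c (at r))"
  define z where "z = (\<lambda>r. vector_derivative y (at r))"
  define e where "e r = F (c r) (y r)" for r
  have I: "open I" "is_interval I" "I \<noteq> {}" "Ck_on 2 I c"
    and cU: "\<And>r. r \<in> I \<Longrightarrow> c r \<in> U" and y0: "\<And>r. r \<in> I \<Longrightarrow> y r \<noteq> 0"
    using c by (auto simp: regular_path_def y_def)
  have cy: "(c has_vector_derivative y r) (at r)" and yz: "(y has_vector_derivative z r) (at r)"
    if "r \<in> I" for r
    unfolding z_def using Ck_on_2_realD(1,2)[OF I(1,4) that] by (simp_all only: y_def)
  have zc: "continuous_on I z"
    unfolding z_def y_def by (rule Ck_on_2_realD(3)[OF I(1,4)])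
  obtain g where g: "continuous_on I g" "\<And>r. r \<in> I \<Longrightarrow> (e has_real_derivative g r) (at r)"
    using speed_C1[OF c] unfolding e_def y_def by blast
  have e: "e r > 0" if "r \<in> I" for r using speed_pos cU y0 that by (simp add: e_def)
  obtain J h where J: "open J" "is_interval J" "J \<noteq> {}" "h ` J = I" "Ck_on 2 J h"
    and h1: "\<And>w. w \<in> J \<Longrightarrow> (h has_real_derivative 1 / e (h w)) (at w)"
    and h2: "\<And>w. w \<in> J \<Longrightarrow> ((\<lambda>w. 1 / e (h w)) has_real_derivative - g (h w) / e (h w) ^ 3) (at w)"
    and h2c: "continuous_on J (\<lambda>w. - g (h w) / e (h w) ^ 3)"
    using inverse_of_antiderivative[OF I(1-3) e g(2,1)] by blast
  have hI: "h w \<in> I" if "w \<in> J" for w using J(4) that by blast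
  define d where "d w = c (h w)" for w
  define d1 where "d1 w = (1 / e (h w)) *\<^sub>R y (h w)" for w
  define d2 where "d2 w = (1 / e (h w))\<^sup>2 *\<^sub>R z (h w) + (- g (h w) / e (h w) ^ 3) *\<^sub>R y (h w)" for w
  have D1: "(d has_vector_derivative d1 w) (at w)" and D2: "(d1 has_vector_derivative d2 w) (at w)"
    if "w \<in> J" for w
    using reparametrization_DERIVs[of h "\<lambda>w. 1 / e (h w)", OF h1[OF that] h2[OF that]
        cy[OF hI[OF that]] yz[OF hI[OF that]]]
    unfolding d_def d1_def d2_def by blast+
  have hc: "continuous_on J h"
    using h1 DERIV_isCont continuous_at_imp_continuous_on by blast
  have yc: "continuous_on I y"
    using yz has_vector_derivative_continuous continuous_at_imp_continuous_on by blast
  have ec: "continuous_on I e"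
    using g(2) DERIV_isCont continuous_at_imp_continuous_on by blast
  have "continuous_on J d2" unfolding d2_def
    by (intro continuous_intros h2c continuous_on_compose2[OF yc hc] continuous_on_compose2[OF ec hc]
        continuous_on_compose2[OF zc hc]) (use hI e in force)+
  from Ck_on_2_realI[OF J(1) D1 D2 this] have Ck: "Ck_on 2 J d" .
  have dd: "vector_derivative d (at w) = d1 w" if "w \<in> J" for w
    using D1[OF that] vector_derivative_at by blast
  have d1_0: "d1 w \<noteq> 0" if "w \<in> J" for w
    using e y0 hI[OF that] by (force simp: d1_def)
  have dU: "d w \<in> U" if "w \<in> J" for w using cU hI[OF that] by (simp add: d_def)
  have reg: "regular_path U J d"
    using J Ck dd d1_0 dU by (auto simp: regular_path_def)
  have "((\<lambda>w. F (d w) (vector_derivative d (at w))) has_real_derivative 0) (at w)" if "w \<in> J" for w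
  proof (rule has_field_derivative_transform_within_open[OF DERIV_const J(1) that])
    fix v assume v: "v \<in> J"
    have "F (d v) (d1 v) = 1 / e (h v) * e (h v)"
      unfolding d_def d1_def e_def using speed_scale speed_pos cU y0 hI[OF v] by simp
    then show "1 = F (d v) (vector_derivative d (at v))"
      using dd[OF v] e[OF hI[OF v]] by simp
  qed
  moreover have "velocity_det d w = \<kappa> (d w) (vector_derivative d (at w))" if w: "w \<in> J" for w
  proof -
    have "velocity_det d w = d1 w $ 1 * d2 w $ 2 - d1 w $ 2 * d2 w $ 1"
      by (rule velocity_det_eq[OF J(1) w D1 D2[OF w]])
    also have "\<dots> = (1 / e (h w)) ^ 3 * (y (h w) $ 1 * z (h w) $ 2 - y (h w) $ 2 * z (h w) $ 1)"
      by (simp add: d1_def d2_def algebra_simps power2_eq_square power3_eq_cube)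
    also have "y (h w) $ 1 * z (h w) $ 2 - y (h w) $ 2 * z (h w) $ 1 = \<kappa> (c (h w)) (y (h w))"
      using turn[OF hI[OF w]] by (simp add: velocity_det_def y_def z_def Let_def)
    also have "(1 / e (h w)) ^ 3 * \<dots> = \<kappa> (d w) (d1 w)"
      unfolding d_def d1_def using turn_scale cU y0 e hI[OF w] by simp
    finally show ?thesis using dd[OF w] by simp
  qed
  ultimately have "geodesic U F J d" using reg geodesic_eq by blast
  moreover have "deriv h w > 0" if "w \<in> J" for w
    using DERIV_imp_deriv[OF h1[OF that]] e[OF hI[OF that]] by simp
  then have "same_oriented_curve I c J d"
    unfolding same_oriented_curve_def using J(4,5) by (auto simp: d_def)
  ultimately show ?thesis using that by blast
qed

text \<open>In terms of position and angle, and with Euclidean unit speed, the turning equation is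
  the first-order system \<open>X' = dir \<Theta>\<close>,
  \<open>\<Theta>' = \<kappa> X (dir \<Theta>)\<close>. It is solved forward on an open interval, so
  the initial position and angle are attained only as a limit.\<close>

lemma path_exists:
  assumes "x \<in> U"
  obtains \<delta> X \<Theta> where "\<delta> > 0" "regular_path U {0<..<\<delta>} X"
    "\<And>r. r \<in> {0<..<\<delta>} \<Longrightarrow> velocity_det X r = \<kappa> (X r) (vector_derivative X (at r))"
    "\<And>r. r \<in> {0<..<\<delta>} \<Longrightarrow> vector_derivative X (at r) = dir (\<Theta> r)"
    "((\<lambda>r. (X r, \<Theta> r)) \<longlongrightarrow> (x, \<theta>)) (at_right 0)"
proof -
  define G where "G w = (dir (snd w), \<kappa> (fst w) (dir (snd w)))" for w
  have "lipschitz_near G (x, \<theta>)"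
    unfolding G_def by (intro lipschitz_near_Pair lipschitz_near_dir turn_lipschitz assms)
  then obtain d Z where Z: "d > 0" "continuous_on {0..d} Z" "Z 0 = (x, \<theta>)"
    "\<And>t. t \<in> {0<..<d} \<Longrightarrow> (Z has_vector_derivative G (Z t)) (at t)"
    using picard_local by blast
  define X where "X t = fst (Z t)" for t
  define \<Theta> where "\<Theta> t = snd (Z t)" for t
  have lim: "(Z \<longlongrightarrow> (x, \<theta>)) (at_right 0)"
    using continuous_on_Icc_at_rightD[OF Z(2,1)] Z(3) by simp
  then have "(X \<longlongrightarrow> x) (at_right 0)" unfolding X_def using tendsto_fst by fastforce
  \<comment> \<open>The Picard solution may leave \<open>U\<close>, outside of which nothing is
    known about \<open>\<kappa>\<close>; a shorter time interval prevents this.\<close>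
  then have "\<forall>\<^sub>F t in at_right 0. X t \<in> U"
    using open_domain assms topological_tendstoD by blast
  then obtain d' where d': "d' > 0" "\<And>t. 0 < t \<Longrightarrow> t < d' \<Longrightarrow> X t \<in> U"
    unfolding eventually_at_right_field by blast
  define \<delta> where "\<delta> = min d d'"
  let ?I = "{0<..<\<delta>}"
  define k where "k t = \<kappa> (X t) (dir (\<Theta> t))" for t
  have XU: "X t \<in> U" if "t \<in> ?I" for t using that d' by (auto simp: \<delta>_def)
  have DX: "(X has_vector_derivative dir (\<Theta> t)) (at t)"
    and D\<Theta>: "(\<Theta> has_real_derivative k t) (at t)" if "t \<in> ?I" for t
  proof -
    have "(Z has_vector_derivative G (Z t)) (at t)" using that Z(4) by (auto simp: \<delta>_def)
    from bounded_linear.has_vector_derivative[OF bounded_linear_fst this]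
      bounded_linear.has_vector_derivative[OF bounded_linear_snd this]
    show "(X has_vector_derivative dir (\<Theta> t)) (at t)" "(\<Theta> has_real_derivative k t) (at t)"
      by (simp_all add: X_def[abs_def] \<Theta>_def[abs_def] k_def G_def
          has_real_derivative_iff_has_vector_derivative)
  qed
  note DD = dir_has_vector_derivative[OF D\<Theta>]
  have kc: "continuous_on ?I k"
  proof (rule continuous_at_imp_continuous_on, rule ballI)
    fix t assume t: "t \<in> ?I"
    have "isCont X t" "isCont \<Theta> t"
      using DX[OF t] D\<Theta>[OF t] has_vector_derivative_continuous DERIV_isCont by blast+
    then have "isCont (\<lambda>t. (X t, \<Theta> t)) t" by (rule continuous_Pair)
    from isCont_o2[OF this lipschitz_near_imp_isCont[OF turn_lipschitz[OF XU[OF t]]]]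
    show "isCont k t" by (simp add: k_def[abs_def])
  qed
  have \<Theta>c: "continuous_on ?I \<Theta>"
    using D\<Theta> DERIV_isCont continuous_at_imp_continuous_on by blast
  have "continuous_on ?I (\<lambda>t. k t *\<^sub>R dir (\<Theta> t + pi / 2))"
    by (intro continuous_intros kc \<Theta>c)
  from Ck_on_2_realI[OF open_greaterThanLessThan DX DD this] have Ck: "Ck_on 2 ?I X" .
  have vd: "vector_derivative X (at t) = dir (\<Theta> t)" if "t \<in> ?I" for t
    using DX[OF that] vector_derivative_at by blast
  have "regular_path U ?I X"
    using Ck vd XU Z(1) d'(1) by (auto simp: regular_path_def \<delta>_def is_interval_oo)
  moreover have "velocity_det X t = \<kappa> (X t) (vector_derivative X (at t))" if t: "t \<in> ?I" for t
  proof -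
    have "velocity_det X t = dir (\<Theta> t) $ 1 * (k t *\<^sub>R dir (\<Theta> t + pi / 2)) $ 2
        - dir (\<Theta> t) $ 2 * (k t *\<^sub>R dir (\<Theta> t + pi / 2)) $ 1"
      by (rule velocity_det_eq[OF open_greaterThanLessThan t DX DD[OF t]])
    also have "\<dots> = k t * (cos (\<Theta> t) * cos (\<Theta> t) + sin (\<Theta> t) * sin (\<Theta> t))"
      by (simp only: dir_nth vector_scaleR_component cos_add sin_add cos_pi_half sin_pi_half
          real_scaleR_def) algebra
    also have "cos (\<Theta> t) * cos (\<Theta> t) + sin (\<Theta> t) * sin (\<Theta> t) = 1"
      by simp
    finally show ?thesis using vd[OF t] by (simp add: k_def)
  qed
  moreover have "((\<lambda>r. (X r, \<Theta> r)) \<longlongrightarrow> (x, \<theta>)) (at_right 0)"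
    using lim by (simp add: X_def \<Theta>_def)
  moreover have "\<delta> > 0" using Z(1) d'(1) by (simp add: \<delta>_def)
  ultimately show ?thesis using that vd by blast
qed

lemma turn_continuous:
  assumes "x \<in> U" "((\<lambda>r. (X r, \<Theta> r)) \<longlongrightarrow> (x, \<theta>)) (at_right (0::real))"
  shows "((\<lambda>r. \<kappa> (X r) (dir (\<Theta> r))) \<longlongrightarrow> \<kappa> x (dir \<theta>)) (at_right 0)"
  using isCont_tendsto_compose[OF lipschitz_near_imp_isCont[OF turn_lipschitz[OF assms(1)]] assms(2)]
  by simp

end

text \<open>Cubic homogeneity extends the equality from unit directions to all velocities. A
  geodesic of \<open>F\<close> then satisfies the turning equation of \<open>G\<close>, and only its
  parameter needs to be changed.\<close>

lemma geodesics_transfer: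
  assumes "path_geometry U F \<kappa>" "path_geometry U G \<mu>"
    and eq: "\<And>x \<theta>. x \<in> U \<Longrightarrow> \<kappa> x (dir \<theta>) = \<mu> x (dir \<theta>)"
    and geo: "geodesic U F I c"
  shows "\<exists>J d. geodesic U G J d \<and> same_oriented_curve I c J d"
proof -
  interpret F: path_geometry U F \<kappa> by fact
  interpret G: path_geometry U G \<mu> by fact
  have c: "regular_path U I c" using geo F.geodesic_eq by blast
  have "velocity_det c r = \<mu> (c r) (vector_derivative c (at r))" if r: "r \<in> I" for r
  proof -
    let ?y = "vector_derivative c (at r)"
    have *: "c r \<in> U" "?y \<noteq> 0" using c r by (auto simp: regular_path_def)
    obtain \<theta> where \<theta>: "?y = norm ?y *\<^sub>R dir \<theta>" using polar_dir by blast
    have "\<kappa> (c r) (norm ?y *\<^sub>R dir \<theta>) = \<mu> (c r) (norm ?y *\<^sub>R dir \<theta>)"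
      using F.turn_scale[of "c r" "dir \<theta>" "norm ?y"] G.turn_scale[of "c r" "dir \<theta>" "norm ?y"] * eq
      by simp
    then show ?thesis using geo r unfolding F.geodesic_eq \<theta>[symmetric] by simp
  qed
  from G.reparametrize[OF c this] show ?thesis by blast
qed

text \<open>For necessity, a path from \<open>path_exists\<close> becomes an
  \<open>F\<close>-geodesic and, by hypothesis, a \<open>G\<close>-geodesic. Pulling the equation of
  \<open>\<mu>\<close> back through both changes of parameter equates \<open>\<kappa>\<close> and
  \<open>\<mu>\<close> along the path, and continuity carries this to its initial position and
  angle.\<close>

lemma projectively_equivalent_iff:
  assumes "path_geometry U F \<kappa>" "path_geometry U G \<mu>"
  shows "projectively_equivalent U F G \<longleftrightarrow> (\<forall>x\<in>U. \<forall>\<theta>. \<kappa> x (dir \<theta>) = \<mu> x (dir \<theta>))"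
proof
  assume eq: "\<forall>x\<in>U. \<forall>\<theta>. \<kappa> x (dir \<theta>) = \<mu> x (dir \<theta>)"
  show "projectively_equivalent U F G"
    unfolding projectively_equivalent_def
    using geodesics_transfer[OF assms] geodesics_transfer[OF assms(2,1)] eq by simp
next
  assume pe: "projectively_equivalent U F G"
  interpret F: path_geometry U F \<kappa> by fact
  interpret G: path_geometry U G \<mu> by fact
  show "\<forall>x\<in>U. \<forall>\<theta>. \<kappa> x (dir \<theta>) = \<mu> x (dir \<theta>)"
  proof (intro ballI allI)
    fix x \<theta> assume x: "x \<in> U"
    obtain \<delta> X \<Theta> where X: "\<delta> > 0" "regular_path U {0<..<\<delta>} X"
      "\<And>r. r \<in> {0<..<\<delta>} \<Longrightarrow> velocity_det X r = \<kappa> (X r) (vector_derivative X (at r))"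
      "\<And>r. r \<in> {0<..<\<delta>} \<Longrightarrow> vector_derivative X (at r) = dir (\<Theta> r)"
      and lim: "((\<lambda>r. (X r, \<Theta> r)) \<longlongrightarrow> (x, \<theta>)) (at_right 0)"
      using F.path_exists[OF x, of \<theta>] by blast
    obtain J c where c: "geodesic U F J c" "same_oriented_curve {0<..<\<delta>} X J c"
      using F.reparametrize[OF X(2,3)] by blast
    obtain K d where d: "geodesic U G K d" "same_oriented_curve J c K d"
      using pe c(1) unfolding projectively_equivalent_def by blast
    have reg: "regular_path U J c" "regular_path U K d"
      using c(1) d(1) F.geodesic_eq G.geodesic_eq by blast+
    then have "open J" "open K" by (auto simp: regular_path_def)
    have "velocity_det c r = \<mu> (c r) (vector_derivative c (at r))" if "r \<in> J" for r
      by (rule turning_transfer[OF G.turn_scale reg(1) \<open>open K\<close> d(2) _ that])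
        (use d(1) G.geodesic_eq in blast)+
    from turning_transfer[OF G.turn_scale X(2) \<open>open J\<close> c(2) this]
    have "\<kappa> (X r) (dir (\<Theta> r)) = \<mu> (X r) (dir (\<Theta> r))" if "r \<in> {0<..<\<delta>}" for r
      using X(3,4)[OF that] that by simp
    then have "\<forall>\<^sub>F r in at_right 0. \<kappa> (X r) (dir (\<Theta> r)) = \<mu> (X r) (dir (\<Theta> r))"
      using X(1) by (auto simp: eventually_at_right_field intro!: exI[of _ \<delta>])
    from tendsto_cong[OF this] F.turn_continuous[OF x lim]
    have "((\<lambda>r. \<mu> (X r) (dir (\<Theta> r))) \<longlongrightarrow> \<kappa> x (dir \<theta>)) (at_right 0)" by blast
    from tendsto_unique[OF _ this G.turn_continuous[OF x lim]]
    show "\<kappa> x (dir \<theta>) = \<mu> x (dir \<theta>)" by simp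
  qed
qed

lemma (in conformal_alpha_beta) path_geometry: "path_geometry U F (turning \<nu> b \<phi>)"
proof
  show "\<exists>g. continuous_on I g \<and>
      (\<forall>r\<in>I. ((\<lambda>r. F (c r) (vector_derivative c (at r))) has_real_derivative g r) (at r))"
    if "regular_path U I c" for I c
    using speed_continuously_differentiable[OF that] by metis
qed (rule open_U geodesic_iff F_pos F_scale turning_scale lipschitz_turning; assumption)+

subsection \<open>The reversibility condition\<close>

text \<open>The left-hand side carries the signed derivative \<open>B2 cos t - B1 sin t\<close> of \<open>B1 cos t + B2 sin t\<close>, the
  right-hand side its absolute value.\<close>

lemma circle_condition_iff:
  fixes B1 B2 m1 m2 m3 c :: real and E F :: "real \<Rightarrow> real"
  defines "r \<equiv> sqrt (B1\<^sup>2 + B2\<^sup>2)"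
  assumes odd: "\<And>s. E (- s) = - E s" and even: "\<And>s. F (- s) = F s"
    and vanish: "\<And>k s. r > 0 \<Longrightarrow> (\<And>s. s \<in> {0..r} \<Longrightarrow> F s = k * s * (r\<^sup>2 - s\<^sup>2) * E s) \<Longrightarrow>
      s \<in> {0..r} \<Longrightarrow> F s = 0"
  shows "(\<forall>t. (B2 * cos t - B1 * sin t) * E (B1 * cos t + B2 * sin t)
        * (m1 * (cos t)\<^sup>2 + m2 * (sin t * cos t) + m3 * (sin t)\<^sup>2) + F (B1 * cos t + B2 * sin t) * c = 0) \<longleftrightarrow>
    (\<forall>t\<in>{0..<2 * pi}. sqrt (B1\<^sup>2 + B2\<^sup>2 - (B1 * cos t + B2 * sin t)\<^sup>2) * E (B1 * cos t + B2 * sin t)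
        * (m1 * (cos t)\<^sup>2 + m2 * (sin t * cos t) + m3 * (sin t)\<^sup>2) + F (B1 * cos t + B2 * sin t) * c = 0)"
proof -
  define S where "S p q = B1 * p + B2 * q" for p q
  define T where "T p q = B2 * p - B1 * q" for p q
  define M where "M p q = m1 * p\<^sup>2 + m2 * (q * p) + m3 * q\<^sup>2" for p q
  have r2: "r\<^sup>2 = B1\<^sup>2 + B2\<^sup>2" and r0: "r \<ge> 0" by (simp_all add: r_def)
  have T2: "r\<^sup>2 - (S p q)\<^sup>2 = (T p q)\<^sup>2" if "p\<^sup>2 + q\<^sup>2 = 1" for p q
  proof -
    have "r\<^sup>2 * (p\<^sup>2 + q\<^sup>2) - (S p q)\<^sup>2 = (T p q)\<^sup>2"
      unfolding r2 S_def T_def by (simp add: power2_eq_square algebra_simps)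
    then show ?thesis using that by simp
  qed
  have abs: "sqrt (r\<^sup>2 - (S p q)\<^sup>2) = \<bar>T p q\<bar>" if "p\<^sup>2 + q\<^sup>2 = 1" for p q
    unfolding T2[OF that] by simp
  \<comment> \<open>Points of the unit circle replace the angle, so that the two sides may use
    different ranges of \<open>t\<close>.\<close>
  have circle: "(\<forall>t\<in>X. Z (cos t) (sin t)) \<longleftrightarrow> (\<forall>p q. p\<^sup>2 + q\<^sup>2 = 1 \<longrightarrow> Z p q)"
    if "{0..<2 * pi} \<subseteq> X" for X and Z :: "real \<Rightarrow> real \<Rightarrow> bool"
  proof
    assume Z: "\<forall>t\<in>X. Z (cos t) (sin t)"
    show "\<forall>p q. p\<^sup>2 + q\<^sup>2 = 1 \<longrightarrow> Z p q"
    proof (intro allI impI)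
      fix p q :: real assume "p\<^sup>2 + q\<^sup>2 = 1"
      then obtain t where "0 \<le> t" "t < 2 * pi" "p = cos t" "q = sin t"
        using sincos_total_2pi by blast
      then show "Z p q" using Z that by auto
    qed
  qed auto
  have "(\<forall>p q. p\<^sup>2 + q\<^sup>2 = 1 \<longrightarrow> T p q * E (S p q) * M p q + F (S p q) * c = 0) \<longleftrightarrow>
    (\<forall>p q. p\<^sup>2 + q\<^sup>2 = 1 \<longrightarrow> \<bar>T p q\<bar> * E (S p q) * M p q + F (S p q) * c = 0)" (is "?L \<longleftrightarrow> ?R")
  proof
    assume R: ?R
    show ?L
    proof (intro allI impI)
      fix p q :: real assume pq: "p\<^sup>2 + q\<^sup>2 = 1"
      have "\<bar>T p q\<bar> * E (S p q) * M p q + F (S p q) * c = 0" using R pq by blast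
      moreover have "\<bar>T p q\<bar> * E (S p q) * M p q - F (S p q) * c = 0"
      proof -
        \<comment> \<open>The antipodal point belongs to \<open>t + \<pi>\<close>. Only
          \<open>S\<close>, and with it \<open>E\<close>, changes sign, so adding and subtracting
          the two equations separates the summands.\<close>
        have "S (- p) (- q) = - S p q" "\<bar>T (- p) (- q)\<bar> = \<bar>T p q\<bar>" "M (- p) (- q) = M p q"
          by (simp_all add: S_def T_def M_def)
        then show ?thesis using R[rule_format, of "-p" "-q"] pq by (simp add: odd even)
      qed
      ultimately have "F (S p q) * c = 0" "\<bar>T p q\<bar> * E (S p q) * M p q = 0" by linarith+
      then show "T p q * E (S p q) * M p q + F (S p q) * c = 0" by auto
    qed
  next
    assume L: ?L
    have Fc: "F s * c = 0" if s: "s \<in> {0..r}" for s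
    proof (cases "c = 0")
      case c: False
      show ?thesis
      proof (cases "r = 0")
        case True
        \<comment> \<open>Here \<beta> vanishes at the base point: \<open>T\<close> is zero on the
          whole circle and \<open>s = 0\<close> is the only value left.\<close>
        then have "B1 = 0" "B2 = 0" using r2 by (simp_all add: sum_power2_eq_zero_iff)
        then show ?thesis using L[rule_format, of 1 0] s True by (simp add: S_def T_def)
      next
        case False
        then have r: "r > 0" using r0 by simp
        define e1 where "e1 = B1 / r"
        define e2 where "e2 = B2 / r"
        have B: "B1 = r * e1" "B2 = r * e2" using r by (simp_all add: e1_def e2_def)
        have e: "e1\<^sup>2 + e2\<^sup>2 = 1" unfolding e1_def e2_def power_divide
            add_divide_distrib[symmetric] r2[symmetric] using r by simp
        \<comment> \<open>\<open>\<alpha> * \<gamma> * \<mu>\<close> is the difference of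
          \<open>M\<close> between the two reflected points below; up to the factor
          \<open>2 * c * r\<^sup>2\<close> and a sign, \<open>\<mu>\<close> is the constant
          \<open>k\<close> of \<open>vanish\<close>.\<close>
        define \<mu> where "\<mu> = 4 * (m1 - m3) * e1 * e2 + 2 * m2 * (e2\<^sup>2 - e1\<^sup>2)"
        have "F s = 0"
        proof (rule vanish[OF r _ s])
          fix s assume s: "s \<in> {0..r}"
          define \<alpha> where "\<alpha> = s / r"
          define \<gamma> where "\<gamma> = sqrt (1 - \<alpha>\<^sup>2)"
          have "\<alpha>\<^sup>2 \<le> 1" using s r by (simp add: \<alpha>_def abs_square_le_1)
          then have \<gamma>: "\<gamma>\<^sup>2 = 1 - \<alpha>\<^sup>2" by (simp add: \<gamma>_def)
          have sr: "s = r * \<alpha>" using r by (simp add: \<alpha>_def)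
          \<comment> \<open>With \<open>e\<close> the unit direction of \<beta>, the unit vectors on
            which \<open>S\<close> equals \<open>s\<close> are \<open>\<alpha>\<close> times
            \<open>e\<close> plus \<open>g\<close> times its quarter turn, where \<open>g\<close> is
            \<open>\<gamma>\<close> or \<open>- \<gamma>\<close>.\<close>
          have unit: "(\<alpha> * e1 - g * e2)\<^sup>2 + (\<alpha> * e2 + g * e1)\<^sup>2 = 1" if "g\<^sup>2 = 1 - \<alpha>\<^sup>2" for g
          proof -
            have "(\<alpha> * e1 - g * e2)\<^sup>2 + (\<alpha> * e2 + g * e1)\<^sup>2 = (\<alpha>\<^sup>2 + g\<^sup>2) * (e1\<^sup>2 + e2\<^sup>2)"
              by (simp add: power2_eq_square algebra_simps)
            then show ?thesis using that e by simp
          qed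
          have Sg: "S (\<alpha> * e1 - g * e2) (\<alpha> * e2 + g * e1) = s" for g
          proof -
            have "S (\<alpha> * e1 - g * e2) (\<alpha> * e2 + g * e1) = r * \<alpha> * (e1\<^sup>2 + e2\<^sup>2)"
              by (simp add: S_def B power2_eq_square algebra_simps)
            then show ?thesis using e sr by simp
          qed
          have Tg: "T (\<alpha> * e1 - g * e2) (\<alpha> * e2 + g * e1) = - r * g" for g
          proof -
            have "T (\<alpha> * e1 - g * e2) (\<alpha> * e2 + g * e1) = - r * g * (e1\<^sup>2 + e2\<^sup>2)"
              by (simp add: T_def B power2_eq_square algebra_simps)
            then show ?thesis using e by simp
          qed
          have "- r * g * E s * M (\<alpha> * e1 - g * e2) (\<alpha> * e2 + g * e1) + F s * c = 0"
            if "g\<^sup>2 = 1 - \<alpha>\<^sup>2" for g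
            using L[rule_format, OF unit[OF that]] by (simp only: Sg Tg)
          \<comment> \<open>\<open>T\<close> takes opposite values at the two points, while
            \<open>F s\<close> and \<open>E s\<close> agree; adding the equations doubles
            \<open>F s * c\<close> and leaves the difference of \<open>M\<close>.\<close>
          from this[of \<gamma>] this[of "-\<gamma>"]
          have "r * \<gamma> * E s * (M (\<alpha> * e1 - (- \<gamma>) * e2) (\<alpha> * e2 + (- \<gamma>) * e1)
              - M (\<alpha> * e1 - \<gamma> * e2) (\<alpha> * e2 + \<gamma> * e1)) + 2 * (F s * c) = 0"
            using \<gamma> by (simp add: algebra_simps)
          moreover have "M (\<alpha> * e1 - (- \<gamma>) * e2) (\<alpha> * e2 + (- \<gamma>) * e1)
              - M (\<alpha> * e1 - \<gamma> * e2) (\<alpha> * e2 + \<gamma> * e1) = \<alpha> * \<gamma> * \<mu>"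
            by (simp add: M_def \<mu>_def power2_eq_square algebra_simps)
          ultimately have "2 * (F s * c) = - (r * \<alpha>) * \<gamma>\<^sup>2 * \<mu> * E s"
            by (simp add: power2_eq_square algebra_simps)
          also have "\<dots> = - s * (1 - \<alpha>\<^sup>2) * \<mu> * E s" unfolding \<gamma> sr ..
          finally have "F s = - s * (1 - \<alpha>\<^sup>2) * \<mu> * E s / (2 * c)"
            using c by (simp add: field_simps)
          also have "1 - \<alpha>\<^sup>2 = (r\<^sup>2 - s\<^sup>2) / r\<^sup>2"
            using r by (simp add: \<alpha>_def power_divide diff_divide_distrib)
          also have "- s * (d / R) * \<mu> * e / (2 * c) = (- \<mu> / (2 * c * R)) * s * d * e" for d R e
            by (simp add: ac_simps)
          finally show "F s = (- \<mu> / (2 * c * r\<^sup>2)) * s * (r\<^sup>2 - s\<^sup>2) * E s" .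
        qed
        then show ?thesis by simp
      qed
    qed simp
    show ?R
    proof (intro allI impI)
      fix p q :: real assume pq: "p\<^sup>2 + q\<^sup>2 = 1"
      have "(S p q)\<^sup>2 \<le> r\<^sup>2" using T2[OF pq] by (metis diff_ge_0_iff_ge zero_le_power2)
      then have "\<bar>S p q\<bar> \<in> {0..r}" using r0 abs_le_square_iff[of "S p q" r] by simp
      then have "F \<bar>S p q\<bar> * c = 0" by (rule Fc)
      \<comment> \<open>Evenness of \<open>F\<close> extends the vanishing from
        \<open>[0, r]\<close> to negative values of \<open>S\<close>; the other summand must then
        vanish too, whatever the sign of \<open>T\<close>.\<close>
      then have F0: "F (S p q) * c = 0" using even[of "S p q"] by (auto simp: abs_if split: if_splits)
      then have "T p q * E (S p q) * M p q = 0" using L pq by fastforce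
      then show "\<bar>T p q\<bar> * E (S p q) * M p q + F (S p q) * c = 0" using F0 by auto
    qed
  qed
  also have "?R \<longleftrightarrow> (\<forall>p q. p\<^sup>2 + q\<^sup>2 = 1 \<longrightarrow>
      sqrt (r\<^sup>2 - (S p q)\<^sup>2) * E (S p q) * M p q + F (S p q) * c = 0)"
    using abs by auto
  finally have *: "?L \<longleftrightarrow> \<dots>" .
  show ?thesis
    using * circle[of UNIV "\<lambda>p q. T p q * E (S p q) * M p q + F (S p q) * c = 0"]
      circle[of "{0..<2 * pi}" "\<lambda>p q. sqrt (r\<^sup>2 - (S p q)\<^sup>2) * E (S p q) * M p q + F (S p q) * c = 0"]
    unfolding S_def T_def M_def r2 by simp
qed

text \<open>The first term is the curvature of the geodesics of \<alpha>, which is all that remains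
  for constant \<phi>. Apart from a factor \<open>exp (\<nu> x)\<close>, \<open>calM\<close> is the
  covariant derivative of \<beta> evaluated twice on the \<alpha>-unit vector of angle
  \<open>t\<close>; the gradient terms of \<nu> in it are the Christoffel symbols.\<close>

lemma turning_dir_eq:
  fixes \<nu> b \<phi> x t
  defines "s \<equiv> exp (- \<nu> x) * (b x $ 1 * cos t + b x $ 2 * sin t)"
    and "s' \<equiv> exp (- \<nu> x) * (b x $ 2 * cos t - b x $ 1 * sin t)"
  defines "P \<equiv> \<phi> s - s * deriv \<phi> s + s'\<^sup>2 * deriv (deriv \<phi>) s"
  assumes "P \<noteq> 0"
  shows "turning \<nu> b \<phi> x (dir t) = (partial_deriv 2 \<nu> x * cos t - partial_deriv 1 \<nu> x * sin t)
    - (deriv (deriv \<phi>) s * s' * calM \<nu> b x t + deriv \<phi> s * (exp (- \<nu> x) * curl21 b x)) / P"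
proof -
  let ?u = "exp (\<nu> x)"
  define D where "D = partial_deriv 2 \<nu> x * cos t - partial_deriv 1 \<nu> x * sin t"
  define q where "q = cos t * (partial_deriv 1 (\<lambda>x. b x $ 1) x * cos t + partial_deriv 1 (\<lambda>x. b x $ 2) x * sin t)
           + sin t * (partial_deriv 2 (\<lambda>x. b x $ 1) x * cos t + partial_deriv 2 (\<lambda>x. b x $ 2) x * sin t)"
  define m where "m = partial_deriv 1 \<nu> x * cos t + partial_deriv 2 \<nu> x * sin t"
  define c where "c = exp (- \<nu> x) * curl21 b x"
  have ue: "exp (- \<nu> x) = 1 / ?u" by (simp add: exp_minus inverse_eq_divide)
  have s: "(b x $ 1 * cos t + b x $ 2 * sin t) / ?u = s" by (simp add: s_def ue)
  have p: "b x $ 2 * cos t - b x $ 1 * sin t = ?u * s'" by (simp add: s'_def ue)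
  have curl: "curl21 b x = ?u * c" by (simp add: c_def ue)
  have "calM \<nu> b x t = exp (- \<nu> x) * q + s' * D - s * m"
    unfolding calM_def Let_def s_def s'_def D_def q_def m_def
    by (simp add: power2_eq_square algebra_simps)
  then have q: "q = ?u * (calM \<nu> b x t - s' * D + s * m)"
    by (simp add: ue field_simps)
  have "turning \<nu> b \<phi> x (dir t) =
      (?u * ?u * (\<phi> s - s * deriv \<phi> s) * D - deriv (deriv \<phi>) s * (?u * s') * (q - s * ?u * m)
        - ?u * deriv \<phi> s * (?u * c))
      / (?u * ?u * (\<phi> s - s * deriv \<phi> s + (?u * s' / ?u) * (?u * s' / ?u) * deriv (deriv \<phi>) s))"
    unfolding turning_dir Let_def s p D_def[symmetric] q_def[symmetric] m_def[symmetric] curl ..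
  also have "\<dots> = (?u * ?u * (P * D - (deriv (deriv \<phi>) s * s' * calM \<nu> b x t + deriv \<phi> s * c))) / (?u * ?u * P)"
    unfolding q P_def by (rule arg_cong2[where f = "(/)"]) (simp_all add: power2_eq_square algebra_simps)
  also have "\<dots> = D - (deriv (deriv \<phi>) s * s' * calM \<nu> b x t + deriv \<phi> s * c) / P"
    using \<open>P \<noteq> 0\<close> by (simp add: diff_divide_distrib)
  finally show ?thesis by (simp add: D_def c_def)
qed

section \<open>Translation of metric and form into isothermal coordinates\<close>

lemma isothermal_scaleR:
  assumes "isothermal U a \<nu>" "x \<in> U"
  shows "a x = (exp (\<nu> x))\<^sup>2 *\<^sub>R mat 1"
  using assms by (simp add: isothermal_def vec_eq_iff mat_def exp_double)

lemma alpha_isothermal: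
  assumes "isothermal U a \<nu>" "x \<in> U"
  shows "alpha a x y = exp (\<nu> x) * norm y"
proof -
  have "(\<Sum>i\<in>UNIV. \<Sum>j\<in>UNIV. a x $ i $ j * y $ i * y $ j) = (exp (\<nu> x) * norm y)\<^sup>2"
    unfolding isothermal_scaleR[OF assms] sum_2 power_mult_distrib norm_sq_2
    by (simp add: mat_def power2_eq_square algebra_simps)
  then show ?thesis by (simp add: alpha_def)
qed

lemma matrix_inv_scaleR_mat:
  fixes k :: real
  assumes "k \<noteq> 0"
  shows "matrix_inv (k *\<^sub>R mat 1 :: real^'n^'n) = (1 / k) *\<^sub>R mat 1"
proof -
  have mult: "(c *\<^sub>R mat 1) ** X = c *\<^sub>R X" for c and X :: "real^'n^'n"
    by (simp add: vec_eq_iff matrix_matrix_mult_def mat_def if_distrib if_distribR sum.delta' cong: if_cong)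
  let ?A = "k *\<^sub>R mat 1 :: real^'n^'n"
  have "?A ** ((1 / k) *\<^sub>R mat 1) = mat 1 \<and> ((1 / k) *\<^sub>R mat 1) ** ?A = mat 1"
    unfolding mult using assms by simp
  \<comment> \<open>\<open>matrix_inv\<close> is defined by choice, so an inverse must be exhibited
    before the chosen matrix is known to be one.\<close>
  then have "?A ** matrix_inv ?A = mat 1"
    unfolding matrix_inv_def by (rule someI2) blast
  then have "(1 / k) *\<^sub>R (k *\<^sub>R matrix_inv ?A) = (1 / k) *\<^sub>R mat 1"
    unfolding mult by simp
  then show ?thesis using assms by simp
qed

lemma form_norm_isothermal:
  assumes "isothermal U a \<nu>" "x \<in> U"
  shows "form_norm a b x = norm (b x) / exp (\<nu> x)"
proof -
  have "matrix_inv (a x) = (1 / (exp (\<nu> x))\<^sup>2) *\<^sub>R mat 1"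
    unfolding isothermal_scaleR[OF assms] by (rule matrix_inv_scaleR_mat) simp
  then have "(\<Sum>i\<in>UNIV. \<Sum>j\<in>UNIV. matrix_inv (a x) $ i $ j * b x $ i * b x $ j) = (norm (b x) / exp (\<nu> x))\<^sup>2"
    unfolding sum_2 power_divide norm_sq_2 by (simp add: mat_def power2_eq_square field_simps)
  then show ?thesis by (simp add: form_norm_def)
qed

lemma calE_minus: "calE \<phi> (- s) = - calE \<phi> s"
  by (simp add: calE_def algebra_simps)

lemma calF_minus: "calF \<phi> r (- s) = calF \<phi> r s"
  by (simp add: calF_def algebra_simps)

lemma alpha_beta_imp_conformal:
  assumes "open U" "isothermal U a \<nu>" "alpha_beta_metric U a b b0 \<phi> F"
  shows "conformal_alpha_beta U \<nu> b b0 \<phi> F"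
proof
  show "F x y = exp (\<nu> x) * norm y * \<phi> ((b x \<bullet> y) / (exp (\<nu> x) * norm y))" if "x \<in> U" for x y
    using assms(3) that unfolding alpha_beta_metric_def
    by (simp add: alpha_isothermal[OF assms(2)] beta_def inner_vec_def)
  show "norm (b x) / exp (\<nu> x) < b0" if "x \<in> U" for x
    using assms(3) form_norm_isothermal[OF assms(2) that, of b] that
    unfolding alpha_beta_metric_def by auto
qed (use assms in \<open>simp_all add: isothermal_def alpha_beta_metric_def\<close>)

section \<open>Curvatures of the norm and of its reverse\<close>

context conformal_alpha_beta
begin

text \<open>Since \<alpha> is even and \<beta> odd in the velocity, reversing the norm keeps \<phi>
  and replaces \<open>b\<close> by \<open>- b\<close>.\<close>

lemma reverse: "conformal_alpha_beta U \<nu> (\<lambda>x. - b x) b0 \<phi> (reverse_norm F)"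
proof
  show "smooth_on U (\<lambda>x. - b x)"
    by (rule smooth_on_bounded_linear[OF open_U bounded_linear_minus[OF bounded_linear_ident] smooth_b])
qed (simp_all add: open_U smooth_nu smooth_phi phi_pos elliptic norm_b reverse_norm_def F_eq)

lemma db_minus:
  assumes "x \<in> U" shows "partial_deriv i (\<lambda>x. (- b x) $ j) x = - db i j x"
  unfolding vector_uminus_component partial_deriv_def[of i "\<lambda>x. b x $ j"]
  by (rule partial_deriv_eqI[OF has_derivative_minus[OF smooth_on_has_derivative[OF smooth_b_nth assms]]])

text \<open>Under reversal \<open>s\<close>, \<open>s'\<close>, \<open>calM\<close> and the curl all
  change sign, so the product of \<open>s'\<close> and \<open>calM\<close> is kept while the curl
  term is reversed. The part from \<alpha> cancels, and the positive denominators can be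
  cleared.\<close>

lemma turning_reverse_iff:
  fixes t :: real
  assumes "x \<in> U"
  defines "s \<equiv> exp (- \<nu> x) * (b x $ 1 * cos t + b x $ 2 * sin t)"
    and "s' \<equiv> exp (- \<nu> x) * (b x $ 2 * cos t - b x $ 1 * sin t)"
  shows "turning \<nu> b \<phi> x (dir t) = turning \<nu> (\<lambda>x. - b x) \<phi> x (dir t) \<longleftrightarrow>
    s' * calE \<phi> s * calM \<nu> b x t + calF \<phi> ((norm (b x) / exp (\<nu> x))\<^sup>2) s * (exp (- \<nu> x) * curl21 b x) = 0"
proof -
  define r where "r = norm (b x) / exp (\<nu> x)"
  define c where "c = exp (- \<nu> x) * curl21 b x"
  define m where "m = calM \<nu> b x t"
  define D where "D = partial_deriv 2 \<nu> x * cos t - partial_deriv 1 \<nu> x * sin t"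
  have sS: "s = S x (dir t)" by (simp add: s_def inner_dir exp_minus field_simps)
  have rs: "r\<^sup>2 - s\<^sup>2 = s'\<^sup>2"
  proof -
    have "(exp (- \<nu> x))\<^sup>2 * ((b x \<bullet> dir t)\<^sup>2 + (b x $ 2 * dir t $ 1 - b x $ 1 * dir t $ 2)\<^sup>2)
        = (exp (- \<nu> x))\<^sup>2 * (norm (b x))\<^sup>2"
      unfolding Lagrange_2 by simp
    then have "s\<^sup>2 + s'\<^sup>2 = (exp (- \<nu> x) * norm (b x))\<^sup>2"
      unfolding s_def s'_def inner_dir dir_nth power_mult_distrib distrib_left[of "(exp (- \<nu> x))\<^sup>2"] .
    also have "exp (- \<nu> x) * norm (b x) = r" by (simp add: r_def exp_minus field_simps)
    finally show ?thesis by simp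
  qed
  have sr: "\<bar>s\<bar> \<le> r" and rb: "r < b0"
    using S_bound[OF dir_nonzero, of x t] norm_b[OF assms(1)] unfolding sS r_def by blast+
  define P where "P = \<phi> s - s * \<phi>1 s + s'\<^sup>2 * \<phi>2 s"
  define P' where "P' = \<phi> (- s) + s * \<phi>1 (- s) + s'\<^sup>2 * \<phi>2 (- s)"
  have P: "P > 0" "P' > 0"
    using elliptic[OF sr rb] elliptic[of "- s" r] sr rb rs by (simp_all add: P_def P'_def)
  have min: "exp (- \<nu> x) * ((- b x) $ 1 * cos t + (- b x) $ 2 * sin t) = - s"
    "exp (- \<nu> x) * ((- b x) $ 2 * cos t - (- b x) $ 1 * sin t) = - s'"
    by (simp_all add: s_def s'_def algebra_simps)
  have curl: "curl21 (\<lambda>x. - b x) x = - curl21 b x"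
    unfolding curl21_def db_minus[OF assms(1)] by simp
  have M: "calM \<nu> (\<lambda>x. - b x) x t = - m"
    unfolding m_def calM_def Let_def db_minus[OF assms(1)] by (simp add: algebra_simps)
  have 1: "turning \<nu> b \<phi> x (dir t) = D - (\<phi>2 s * s' * m + \<phi>1 s * c) / P"
    using turning_dir_eq[of \<phi> \<nu> x b t, folded s_def s'_def] P
    unfolding P_def D_def c_def m_def by simp
  have 2: "turning \<nu> (\<lambda>x. - b x) \<phi> x (dir t) = D - (\<phi>2 (- s) * s' * m - \<phi>1 (- s) * c) / P'"
    using turning_dir_eq[of \<phi> \<nu> x "\<lambda>x. - b x" t, unfolded min M curl] P
    unfolding P'_def D_def c_def by simp
  \<comment> \<open>This is the origin of the two coefficients: clearing denominators produces these
    combinations, and in the first one the products of two second derivatives cancel.\<close>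
  have E: "calE \<phi> s = \<phi>2 s * P' - \<phi>2 (- s) * P"
    unfolding calE_def P_def P'_def by (simp add: algebra_simps)
  have F: "calF \<phi> (r\<^sup>2) s = \<phi>1 s * P' + \<phi>1 (- s) * P"
    unfolding calF_def rs P_def P'_def by (simp add: algebra_simps)
  have "turning \<nu> b \<phi> x (dir t) = turning \<nu> (\<lambda>x. - b x) \<phi> x (dir t) \<longleftrightarrow>
      (\<phi>2 s * s' * m + \<phi>1 s * c) * P' = (\<phi>2 (- s) * s' * m - \<phi>1 (- s) * c) * P"
    unfolding 1 2 using P by (simp add: frac_eq_eq)
  also have "\<dots> \<longleftrightarrow> s' * calE \<phi> s * m + calF \<phi> (r\<^sup>2) s * c = 0"
    unfolding E F by (simp add: algebra_simps)
  finally show ?thesis unfolding r_def m_def c_def .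
qed

lemma reversible_condition_iff:
  assumes "x \<in> U"
  shows "(\<forall>t. turning \<nu> b \<phi> x (dir t) = turning \<nu> (\<lambda>x. - b x) \<phi> x (dir t)) \<longleftrightarrow>
    (\<forall>t\<in>{0..<2 * pi}.
      let s = exp (- \<nu> x) * (b x $ 1 * cos t + b x $ 2 * sin t);
          bsq = exp (- 2 * \<nu> x) * ((b x $ 1)\<^sup>2 + (b x $ 2)\<^sup>2)
      in sqrt (bsq - s\<^sup>2) * calE \<phi> s * calM \<nu> b x t
         + calF \<phi> bsq s * exp (- \<nu> x) * curl21 b x = 0)"
proof -
  define u where "u = exp (- \<nu> x)"
  define B where "B i = u * b x $ i" for i
  define r where "r = norm (b x) / exp (\<nu> x)"
  have "exp (- 2 * \<nu> x) = u\<^sup>2" by (simp add: u_def power2_eq_square flip: exp_add)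
  then have bsq: "exp (- 2 * \<nu> x) * ((b x $ 1)\<^sup>2 + (b x $ 2)\<^sup>2) = (B 1)\<^sup>2 + (B 2)\<^sup>2"
    by (simp add: B_def power_mult_distrib distrib_left)
  have r2: "r\<^sup>2 = (B 1)\<^sup>2 + (B 2)\<^sup>2"
    unfolding r_def power_divide norm_sq_2 B_def u_def
    by (simp add: exp_minus power_mult_distrib field_simps)
  have rsqrt: "sqrt ((B 1)\<^sup>2 + (B 2)\<^sup>2) = r"
    unfolding r2[symmetric] by (simp add: r_def)
  have S: "exp (- \<nu> x) * (b x $ 1 * cos t + b x $ 2 * sin t) = B 1 * cos t + B 2 * sin t" for t
    by (simp add: B_def u_def algebra_simps)
  have T: "exp (- \<nu> x) * (b x $ 2 * cos t - b x $ 1 * sin t) = B 2 * cos t - B 1 * sin t" for t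
    by (simp add: B_def u_def algebra_simps)
  have T': "exp (- \<nu> x) * (- (b x $ 1) * sin t + b x $ 2 * cos t) = B 2 * cos t - B 1 * sin t" for t
    by (simp add: B_def u_def algebra_simps)
  \<comment> \<open>The terms with \<open>\<beta>\<close> and its derivative are themselves linear
    in cosine and sine, so \<open>calM\<close> is a quadratic form in them, the shape that
    \<open>circle_condition_iff\<close> requires.\<close>
  have M: "calM \<nu> b x t = (u * db 1 1 x + B 2 * n 2 x - B 1 * n 1 x) * (cos t)\<^sup>2
      + (u * (db 2 1 x + db 1 2 x) - 2 * (B 2 * n 1 x + B 1 * n 2 x)) * (sin t * cos t)
      + (u * db 2 2 x + B 1 * n 1 x - B 2 * n 2 x) * (sin t)\<^sup>2" for t
    unfolding calM_def Let_def S T' unfolding u_def[symmetric]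
    by (simp add: power2_eq_square algebra_simps)
  have vanish: "calF \<phi> (r\<^sup>2) s = 0"
    if "r > 0" "\<And>s. s \<in> {0..r} \<Longrightarrow> calF \<phi> (r\<^sup>2) s = k * s * (r\<^sup>2 - s\<^sup>2) * calE \<phi> s" "s \<in> {0..r}" for k s
    by (rule calF_eq_0[OF that(1) norm_b[OF assms, folded r_def] smooth_phi phi_pos elliptic that(2,3)])
  note circle = circle_condition_iff[of "calE \<phi>" "calF \<phi> (r\<^sup>2)" "B 1" "B 2", unfolded rsqrt,
      OF calE_minus calF_minus vanish]
  show ?thesis
    unfolding turning_reverse_iff[OF assms] Let_def bsq S T M r_def[symmetric] r2[symmetric]
    using circle unfolding r2[symmetric] by (simp only: mult.assoc)
qed

end

theorem theorem4p3:
  fixes U :: "(real^2) set"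
    and a :: "real^2 \<Rightarrow> real^2^2"
    and \<nu> :: "real^2 \<Rightarrow> real"
    and b :: "real^2 \<Rightarrow> real^2"
    and b0 :: real
    and \<phi> :: "real \<Rightarrow> real"
    and F :: "real^2 \<Rightarrow> real^2 \<Rightarrow> real"
  assumes "open U"
    and "riemannian_metric U a"
    and "isothermal U a \<nu>"
    and "alpha_beta_metric U a b b0 \<phi> F"
    and "\<not> projectively_equivalent U F (alpha a)"
    and "\<not> projectively_equivalent U (reverse_norm F) (alpha a)"
  shows "projectively_equivalent U F (reverse_norm F) \<longleftrightarrow>
    (\<forall>x\<in>U. \<forall>t\<in>{0..<2 * pi}.
      let s = exp (- \<nu> x) * (b x $ 1 * cos t + b x $ 2 * sin t);
          bsq = exp (- 2 * \<nu> x) * ((b x $ 1)\<^sup>2 + (b x $ 2)\<^sup>2)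
      in sqrt (bsq - s\<^sup>2) * calE \<phi> s * calM \<nu> b x t
         + calF \<phi> bsq s * exp (- \<nu> x) * curl21 b x = 0)"
proof -
  interpret conformal_alpha_beta U \<nu> b b0 \<phi> F
    by (rule alpha_beta_imp_conformal[OF assms(1,3,4)])
  have "projectively_equivalent U F (reverse_norm F) \<longleftrightarrow>
      (\<forall>x\<in>U. \<forall>t. turning \<nu> b \<phi> x (dir t) = turning \<nu> (\<lambda>x. - b x) \<phi> x (dir t))"
    by (rule projectively_equivalent_iff[OF path_geometry conformal_alpha_beta.path_geometry[OF reverse]])
  also have "\<dots> \<longleftrightarrow> (\<forall>x\<in>U. \<forall>t\<in>{0..<2 * pi}.
      let s = exp (- \<nu> x) * (b x $ 1 * cos t + b x $ 2 * sin t);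
          bsq = exp (- 2 * \<nu> x) * ((b x $ 1)\<^sup>2 + (b x $ 2)\<^sup>2)
      in sqrt (bsq - s\<^sup>2) * calE \<phi> s * calM \<nu> b x t
         + calF \<phi> bsq s * exp (- \<nu> x) * curl21 b x = 0)"
    by (intro ball_cong refl reversible_condition_iff)
  finally show ?thesis .
qed

end
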